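(* For integers $p,q\geqslant2$, let $B_{p,q}=\Delta_{p-1}\times\Delta_{q-1}$ be the product of two simplices and let $B_{p,q}^{\rm ph}=(B_{p,q}^{\rm ph}(s))_{s\geqslant1}$ be the maximal free polyhedron over $B_{p,q}$, explicitly $$B_{p,q}^{\rm ph}(s)=\Bigl\{(E_1,\ldots,E_p,F_1,\ldots,F_q)\ \Big|\ E_i,F_j\in\operatorname{Her}_s(\mathbb C),\ E_i,F_j\geqslant0,\ \sum_{i=1}^pE_i=I_s,\ \sum_{j=1}^qF_j=I_s\Bigr\}.$$ Then the Arveson boundary points of $B_{p,q}^{\rm ph}$ are precisely the pairs of projection-valued measures, that is, the points for which every $E_i$ and every $F_j$ is a projection. Moreover: (1) If $p=q=2$, then $B_{2,2}^{\rm ph}=\operatorname{mconv}(B_{2,2}^{\rm ph}(2))$, and every irreducible Arveson boundary point of $B_{2,2}^{\rm ph}$ has size at most $2$. (2) If $\max\{p,q\}\geqslant3$, then $B_{p,q}^{\rm ph}$ has irreducible Arveson boundary points at unbounded matrix levels (for every $N$ there is $s\geqslant N$ such that $B_{p,q}^{\rm ph}(s)$ contains an irreducible Arveson boundary point), and it is not generated by any fixed finite level (there is no $d\geqslant 1$ with $B_{p,q}^{\rm ph}=\operatorname{mconv}(B_{p,q}^{\rm ph}(d))$).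
   Context: $\Delta_{k-1}$ is the $(k-1)$-dimensional simplex (with $k$ vertices), described in barycentric coordinates. $\operatorname{Her}_s(\mathbb C)$ is the space of Hermitian $s\times s$ complex matrices; a projection is a Hermitian idempotent. For a matrix convex set $K=(K(s))_{s\geqslant1}$ of tuples of Hermitian matrices (all of the same tuple length), $X\in K(s)$ (a point of size $s$) is an Arveson boundary point if, whenever $r\geqslant1$ and a tuple $\widetilde X\in K(s+r)$ has the block form $\widetilde X_i=\begin{pmatrix}X_i&\beta_i\\ \beta_i^*&\gamma_i\end{pmatrix}$ for all coordinates $i$, one has $\beta_i=0$ for all $i$. It is irreducible if the only matrices in $\operatorname{Mat}_s(\mathbb C)$ commuting with all coordinates of $X$ are scalar multiples of $I_s$. $\operatorname{mconv}(K(d))$ is the graded set whose level $s$ consists of all finite sums $\sum_jV_j^*Y^{(j)}V_j$ (coordinatewise) with $Y^{(j)}\in K(d)$, $V_j\in\operatorname{Mat}_{d,s}(\mathbb C)$ and $\sum_jV_j^*V_j=I_s$. *)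

theory Defs
  imports "Jordan_Normal_Form.Schur_Decomposition"
begin

text \<open>
  Points of size \<open>s\<close> are tuples of complex \<open>s \<times> s\<close> matrices, represented as lists. A graded set is
  a function \<open>K\<close> with level \<open>s\<close> given by \<open>K s\<close>; only the levels \<open>s \<ge> 1\<close> are meaningful, so every
  statement about \<open>K\<close> has to carry this guard (there is a \<open>0 \<times> 0\<close> matrix).
\<close>

definition Her :: "nat \<Rightarrow> complex mat set" where
  "Her s = {A \<in> carrier_mat s s. mat_adjoint A = A}"

text \<open>The order \<open>\<le>\<close> that the library puts on matrices is entrywise, hence not the one needed here.\<close>

definition psd :: "nat \<Rightarrow> complex mat \<Rightarrow> bool" where
  "psd s A \<longleftrightarrow> A \<in> Her s \<and> (\<forall>v \<in> carrier_vec s. 0 \<le> Re ((A *\<^sub>v v) \<bullet>c v))"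

definition projection :: "nat \<Rightarrow> complex mat \<Rightarrow> bool" where
  "projection s P \<longleftrightarrow> P \<in> Her s \<and> P * P = P"

definition mat_sum :: "nat \<Rightarrow> ('i \<Rightarrow> complex mat) \<Rightarrow> 'i set \<Rightarrow> complex mat" where
  "mat_sum s A J = mat s s (\<lambda>ab. \<Sum>j\<in>J. A j $$ ab)"

definition povm :: "nat \<Rightarrow> nat \<Rightarrow> complex mat list \<Rightarrow> bool" where
  "povm n s E \<longleftrightarrow> length E = n \<and> (\<forall>i<n. psd s (E ! i)) \<and> mat_sum s (\<lambda>i. E ! i) {..<n} = 1\<^sub>m s"

text \<open>Projections summing to the identity are automatically mutually orthogonal.\<close>

definition pvm :: "nat \<Rightarrow> nat \<Rightarrow> complex mat list \<Rightarrow> bool" where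
  "pvm n s E \<longleftrightarrow> povm n s E \<and> (\<forall>i<n. projection s (E ! i))"

text \<open>The maximal free polyhedron over the product of the simplices with \<open>p\<close> and \<open>q\<close> vertices.\<close>

definition B_ph :: "nat \<Rightarrow> nat \<Rightarrow> nat \<Rightarrow> complex mat list set" where
  "B_ph p q s = {E @ F | E F. povm p s E \<and> povm q s F}"

definition arveson_boundary_point ::
    "(nat \<Rightarrow> complex mat list set) \<Rightarrow> nat \<Rightarrow> complex mat list \<Rightarrow> bool" where
  "arveson_boundary_point K s X \<longleftrightarrow> X \<in> K s \<and>
     (\<forall>r\<ge>1. \<forall>X' \<in> K (s + r). \<forall>\<beta> \<gamma>.
        length X' = length X \<and>
        (\<forall>i<length X. \<beta> i \<in> carrier_mat s r \<and> \<gamma> i \<in> carrier_mat r r \<and>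
           X' ! i = four_block_mat (X ! i) (\<beta> i) (mat_adjoint (\<beta> i)) (\<gamma> i)) \<longrightarrow>
        (\<forall>i<length X. \<beta> i = 0\<^sub>m s r))"

definition irreducible_point :: "nat \<Rightarrow> complex mat list \<Rightarrow> bool" where
  "irreducible_point s X \<longleftrightarrow>
     (\<forall>A \<in> carrier_mat s s. (\<forall>B \<in> set X. A * B = B * A) \<longrightarrow> (\<exists>c. A = c \<cdot>\<^sub>m 1\<^sub>m s))"

text \<open>Level \<open>s\<close> of the matrix convex hull of a set \<open>S\<close> of \<open>n\<close>-tuples of \<open>d \<times> d\<close> matrices.\<close>

definition mconv :: "nat \<Rightarrow> nat \<Rightarrow> complex mat list set \<Rightarrow> nat \<Rightarrow> complex mat list set" where
  "mconv n d S s = {X. length X = n \<and>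
     (\<exists>m Y V. (\<forall>j<m. Y j \<in> S \<and> V j \<in> carrier_mat d s) \<and>
        mat_sum s (\<lambda>j. mat_adjoint (V j) * V j) {..<m::nat} = 1\<^sub>m s \<and>
        (\<forall>i<n. X ! i = mat_sum s (\<lambda>j. mat_adjoint (V j) * (Y j ! i) * V j) {..<m}))}"

definition generated_by_level :: "nat \<Rightarrow> (nat \<Rightarrow> complex mat list set) \<Rightarrow> nat \<Rightarrow> bool" where
  "generated_by_level n K d \<longleftrightarrow> (\<forall>s\<ge>1. K s = mconv n d (K d) s)"

end

(* The Arveson property and the size bound both rest on one rigidity fact: if a projection is
   P = sum V_j^* Y_j V_j with 0 <= Y_j <= I and sum V_j^* V_j = I, then Y_j V_j = V_j P. For a single
   block inclusion V it kills the off-diagonal blocks of a dilation; for a point of mconv it makes each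
   V_j^* V_j commute with the point, hence scalar when the point is irreducible, hence 0 when V_j maps
   to a smaller space. Conversely, an effect E_k that is not a projection gives an explicit nontrivial
   dilation of the measure. Two projections decompose into 2 x 2 pieces because an eigenvector w of
   (2P - I)(2Q - I) spans together with (2Q - I) w a jointly invariant subspace. With a third outcome, a
   rank one projection added at one end of a chain of overlapping 2 x 2 blocks yields an irreducible
   pair of every odd size. *)

theory Submission
  imports Defs "Jordan_Normal_Form.Spectral_Radius"
begin

subsection \<open>Adjoints and ring laws\<close>

text \<open>Generation by level two rests on two explicit decompositions instead of an extreme point
  theorem. Each effect is a corner of its Halmos projection on the doubled space; both effects are
  cut out by the same inclusion, so the two dilations can be chosen independently and still form one
  pair of projections. That pair is then resolved by 2 x 2 pairs. The vectors w and (2Q - I) w need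
  not be orthogonal and may even be parallel; no case distinction arises, because the 2 x 2
  projections are written down formally and only their intertwining relations with P and Q are used.
  Both decompositions need a spectral theorem, and the product of two reflections is unitary but in
  general not Hermitian, so it is proved for normal matrices. For p or q at least 3, two projections
  alone are reducible in size above 2, by the first case. Dimension 2n + 1 has room for two chains
  of n blocks, one missing the last basis vector and the other missing e_0. The second leaves e_0
  free for a further outcome of the same measure, and this outcome makes the commutant
  trivial.\<close>

notation mat_adjoint ("_\<^sup>\<dagger>" [1000] 999)

lemma dim_adjoint [simp]:
  "dim_row (A\<^sup>\<dagger>) = dim_col A" "dim_col (A\<^sup>\<dagger>) = dim_row A"
  by (simp_all add: mat_adjoint_def)

lemma adjoint_carrier [simp, intro]: "A \<in> carrier_mat m n \<Longrightarrow> A\<^sup>\<dagger> \<in> carrier_mat n m"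
  by auto

lemma index_adjoint [simp]:
  "i < dim_col A \<Longrightarrow> j < dim_row A \<Longrightarrow> A\<^sup>\<dagger> $$ (i, j) = cnj (A $$ (j, i))"
  by (simp add: mat_adjoint_def mat_of_rows_index)

lemma index_mult_sum:
  "i < dim_row A \<Longrightarrow> j < dim_col B \<Longrightarrow> dim_col A = dim_row B \<Longrightarrow>
   (A * B) $$ (i, j) = (\<Sum>l<dim_row B. A $$ (i, l) * B $$ (l, j))"
  by (auto simp: scalar_prod_def atLeast0LessThan intro!: sum.cong)

lemma adjoint_adjoint [simp]: "(A\<^sup>\<dagger>)\<^sup>\<dagger> = (A :: complex mat)"
  by (rule eq_matI) auto

lemma adjoint_mult:
  "dim_col A = dim_row B \<Longrightarrow> (A * B)\<^sup>\<dagger> = B\<^sup>\<dagger> * (A :: complex mat)\<^sup>\<dagger>"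
  by (rule eq_matI) (auto simp: index_mult_sum mult.commute simp del: index_mult_mat(1))

lemma adjoint_add:
  "dim_row A = dim_row B \<Longrightarrow> dim_col A = dim_col B \<Longrightarrow> (A + B)\<^sup>\<dagger> = A\<^sup>\<dagger> + (B :: complex mat)\<^sup>\<dagger>"
  by (rule eq_matI) auto

lemma adjoint_minus:
  "dim_row A = dim_row B \<Longrightarrow> dim_col A = dim_col B \<Longrightarrow> (A - B)\<^sup>\<dagger> = A\<^sup>\<dagger> - (B :: complex mat)\<^sup>\<dagger>"
  by (rule eq_matI) auto

lemma adjoint_smult: "(c \<cdot>\<^sub>m A)\<^sup>\<dagger> = cnj c \<cdot>\<^sub>m (A :: complex mat)\<^sup>\<dagger>"
  by (rule eq_matI) auto

lemma adjoint_one [simp]: "(1\<^sub>m n)\<^sup>\<dagger> = (1\<^sub>m n :: complex mat)"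
  by (rule eq_matI) auto

lemma adjoint_zero [simp]: "(0\<^sub>m m n)\<^sup>\<dagger> = (0\<^sub>m n m :: complex mat)"
  by (rule eq_matI) auto

lemma adjoint_four_block:
  assumes "A \<in> carrier_mat n1 m1" "B \<in> carrier_mat n1 m2" "C \<in> carrier_mat n2 m1" "D \<in> carrier_mat n2 m2"
  shows "(four_block_mat A B C D)\<^sup>\<dagger> = four_block_mat (A\<^sup>\<dagger>) (C\<^sup>\<dagger>) (B\<^sup>\<dagger>) (D\<^sup>\<dagger> :: complex mat)"
  using assms by (intro eq_matI) auto

lemmas adjoint_simps = adjoint_mult adjoint_add adjoint_minus adjoint_smult

text \<open>The library states the ring laws with carriers, whose dimensions the simplifier cannot guess
  for compound arguments. With dimension premises they can be used as rewrite rules.\<close>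

lemma mat_ring_dim:
  fixes A B C :: "complex mat"
  shows "dim_col A = dim_row B \<Longrightarrow> dim_col B = dim_row C \<Longrightarrow> A * B * C = A * (B * C)"
    and "dim_row A = dim_row B \<Longrightarrow> dim_col A = dim_col B \<Longrightarrow> dim_col A = dim_row C \<Longrightarrow>
      (A + B) * C = A * C + B * C"
    and "dim_row B = dim_row C \<Longrightarrow> dim_col B = dim_col C \<Longrightarrow> dim_col A = dim_row B \<Longrightarrow>
      A * (B + C) = A * B + A * C"
    and "dim_row A = dim_row B \<Longrightarrow> dim_col A = dim_col B \<Longrightarrow> dim_col A = dim_row C \<Longrightarrow>
      (A - B) * C = A * C - B * C"
    and "dim_row B = dim_row C \<Longrightarrow> dim_col B = dim_col C \<Longrightarrow> dim_col A = dim_row B \<Longrightarrow>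
      A * (B - C) = A * B - A * C"
    and "dim_col A = dim_row B \<Longrightarrow> (c \<cdot>\<^sub>m A) * B = c \<cdot>\<^sub>m (A * B)"
    and "dim_col A = dim_row B \<Longrightarrow> A * (c \<cdot>\<^sub>m B) = c \<cdot>\<^sub>m (A * B)"
    and "dim_row A = n \<Longrightarrow> 1\<^sub>m n * A = A"
    and "dim_col A = n \<Longrightarrow> A * 1\<^sub>m n = A"
    and "dim_row A = n \<Longrightarrow> 0\<^sub>m m n * A = 0\<^sub>m m (dim_col A)"
    and "dim_col A = n \<Longrightarrow> A * 0\<^sub>m n m = 0\<^sub>m (dim_row A) m"
proof -
  note car = carrier_matI[OF refl refl]
  show "A * B * C = A * (B * C)" if "dim_col A = dim_row B" "dim_col B = dim_row C"
    using that by (intro assoc_mult_mat[of A "dim_row A" "dim_row B" B "dim_row C" C "dim_col C"]) auto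
  show "(A + B) * C = A * C + B * C"
    if "dim_row A = dim_row B" "dim_col A = dim_col B" "dim_col A = dim_row C"
    using that by (intro add_mult_distrib_mat[of A "dim_row A" "dim_row C" B C "dim_col C"]) auto
  show "A * (B + C) = A * B + A * C"
    if "dim_row B = dim_row C" "dim_col B = dim_col C" "dim_col A = dim_row B"
    using that by (intro mult_add_distrib_mat[of A "dim_row A" "dim_row C" B "dim_col C" C]) auto
  show "(A - B) * C = A * C - B * C"
    if "dim_row A = dim_row B" "dim_col A = dim_col B" "dim_col A = dim_row C"
    using that by (intro minus_mult_distrib_mat[of A "dim_row A" "dim_row C" B C "dim_col C"]) auto
  show "A * (B - C) = A * B - A * C"
    if "dim_row B = dim_row C" "dim_col B = dim_col C" "dim_col A = dim_row B"
    using that by (intro mult_minus_distrib_mat[of A "dim_row A" "dim_row C" B "dim_col C" C]) auto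
  show "(c \<cdot>\<^sub>m A) * B = c \<cdot>\<^sub>m (A * B)" if "dim_col A = dim_row B"
    using that by (intro mult_smult_assoc_mat[of A "dim_row A" "dim_row B" B "dim_col B"]) auto
  show "A * (c \<cdot>\<^sub>m B) = c \<cdot>\<^sub>m (A * B)" if "dim_col A = dim_row B"
    using that by (intro mult_smult_distrib[of A "dim_row A" "dim_row B" B "dim_col B"]) auto
  show "1\<^sub>m n * A = A" if "dim_row A = n"
    using that by (intro left_mult_one_mat[of A n "dim_col A"]) auto
  show "A * 1\<^sub>m n = A" if "dim_col A = n"
    using that by (intro right_mult_one_mat[of A "dim_row A" n]) auto
  show "0\<^sub>m m n * A = 0\<^sub>m m (dim_col A)" if "dim_row A = n"
    using that by (intro left_mult_zero_mat[of A n "dim_col A"]) auto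
  show "A * 0\<^sub>m n m = 0\<^sub>m (dim_row A) m" if "dim_col A = n"
    using that by (intro right_mult_zero_mat[of A "dim_row A" n]) auto
qed

subsection \<open>Positive semidefinite matrices\<close>

definition quad :: "complex mat \<Rightarrow> complex vec \<Rightarrow> complex" where
  "quad A v = (A *\<^sub>v v) \<bullet>c v"

lemma quad_sum:
  assumes "A \<in> carrier_mat s s" "v \<in> carrier_vec s"
  shows "quad A v = (\<Sum>i<s. \<Sum>j<s. A $$ (i, j) * v $ j * cnj (v $ i))"
  using assms
  by (auto simp: quad_def scalar_prod_def atLeast0LessThan sum_distrib_right intro!: sum.cong)

lemma psd_iff: "psd s A \<longleftrightarrow> A \<in> carrier_mat s s \<and> A\<^sup>\<dagger> = A \<and> (\<forall>v\<in>carrier_vec s. 0 \<le> Re (quad A v))"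
  by (auto simp: psd_def Her_def quad_def)

lemma psd_carrier: "psd s A \<Longrightarrow> A \<in> carrier_mat s s"
  by (auto simp: psd_iff)

lemma quad_add:
  assumes "A \<in> carrier_mat s s" "B \<in> carrier_mat s s" "v \<in> carrier_vec s"
  shows "quad (A + B) v = quad A v + quad B v"
  using assms by (auto simp: quad_sum[of _ s] distrib_right sum.distrib)

lemma psd_add: "psd s A \<Longrightarrow> psd s B \<Longrightarrow> psd s (A + B)"
  by (auto simp: psd_iff adjoint_add quad_add)

lemma mat_sum_carrier [simp]: "mat_sum s A J \<in> carrier_mat s s"
  and dim_mat_sum [simp]: "dim_row (mat_sum s A J) = s" "dim_col (mat_sum s A J) = s"
  and index_mat_sum [simp]: "i < s \<Longrightarrow> j < s \<Longrightarrow> mat_sum s A J $$ (i, j) = (\<Sum>k\<in>J. A k $$ (i, j))"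
  by (auto simp: mat_sum_def)

lemma quad_mat_sum:
  assumes "\<And>j. j \<in> J \<Longrightarrow> A j \<in> carrier_mat s s" "v \<in> carrier_vec s"
  shows "quad (mat_sum s A J) v = (\<Sum>j\<in>J. quad (A j) v)"
proof -
  have "quad (mat_sum s A J) v = (\<Sum>i<s. \<Sum>j<s. \<Sum>k\<in>J. A k $$ (i, j) * v $ j * cnj (v $ i))"
    using assms by (simp add: quad_sum[of _ s] sum_distrib_right)
  also have "\<dots> = (\<Sum>k\<in>J. \<Sum>i<s. \<Sum>j<s. A k $$ (i, j) * v $ j * cnj (v $ i))"
    by (simp add: sum.swap[of _ J])
  finally show ?thesis
    using assms by (simp add: quad_sum[of _ s])
qed

lemma psd_mat_sum: "(\<And>j. j \<in> J \<Longrightarrow> psd s (A j)) \<Longrightarrow> psd s (mat_sum s A J)"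
proof -
  assume *: "\<And>j. j \<in> J \<Longrightarrow> psd s (A j)"
  have "(mat_sum s A J)\<^sup>\<dagger> = mat_sum s A J"
  proof (rule eq_matI)
    fix i j assume "i < dim_row (mat_sum s A J)" "j < dim_col (mat_sum s A J)"
    then have ij: "i < s" "j < s" by auto
    have "cnj (A k $$ (j, i)) = A k $$ (i, j)" if "k \<in> J" for k
    proof -
      have "(A k)\<^sup>\<dagger> $$ (i, j) = A k $$ (i, j)" "A k \<in> carrier_mat s s"
        using *[OF that] by (auto simp: psd_iff)
      then show ?thesis using ij by auto
    qed
    then show "(mat_sum s A J)\<^sup>\<dagger> $$ (i, j) = mat_sum s A J $$ (i, j)"
      using ij by simp
  qed auto
  then show ?thesis
    using * by (auto simp: psd_iff quad_mat_sum intro!: sum_nonneg)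
qed

text \<open>The quadratic form of T^* A T at v is the form of A at T v. Gram matrices, compressions
  and block dilations are all shown to be positive by recognising them as congruences.\<close>

lemma psd_congruence:
  assumes "psd s A" "T \<in> carrier_mat s r"
  shows "psd r (T\<^sup>\<dagger> * A * T)"
proof -
  have A: "A \<in> carrier_mat s s" "A\<^sup>\<dagger> = A" using assms(1) by (auto simp: psd_iff)
  have "quad (T\<^sup>\<dagger> * A * T) v = quad A (T *\<^sub>v v)" if v: "v \<in> carrier_vec r" for v
  proof -
    have Tv: "T *\<^sub>v v \<in> carrier_vec s" using assms v by auto
    have "(T\<^sup>\<dagger> * A * T) *\<^sub>v v = T\<^sup>\<dagger> *\<^sub>v (A *\<^sub>v (T *\<^sub>v v))"
      using A assms v Tv assoc_mult_mat_vec[of "T\<^sup>\<dagger> * A" r s T r v]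
        assoc_mult_mat_vec[of "T\<^sup>\<dagger>" r s A s "T *\<^sub>v v"] mult_carrier_mat[of "T\<^sup>\<dagger>" r s A s] by simp
    moreover have "(T\<^sup>\<dagger> *\<^sub>v w) \<bullet>c v = w \<bullet>c (T *\<^sub>v v)" if w: "w \<in> carrier_vec s" for w
    proof -
      have "(T\<^sup>\<dagger> *\<^sub>v w) \<bullet>c v = (\<Sum>i<r. \<Sum>j<s. cnj (T $$ (j, i)) * w $ j * cnj (v $ i))"
        using assms v w by (auto simp: scalar_prod_def atLeast0LessThan sum_distrib_right intro!: sum.cong)
      also have "\<dots> = (\<Sum>j<s. \<Sum>i<r. cnj (T $$ (j, i)) * w $ j * cnj (v $ i))"
        by (rule sum.swap)
      also have "\<dots> = w \<bullet>c (T *\<^sub>v v)"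
        using assms v w by (auto simp: scalar_prod_def atLeast0LessThan sum_distrib_left sum_distrib_right mult_ac intro!: sum.cong)
      finally show ?thesis .
    qed
    ultimately show ?thesis
      using A Tv by (simp add: quad_def)
  qed
  then show ?thesis
    using assms A by (auto simp: psd_iff adjoint_simps mat_ring_dim)
qed

lemma psd_one: "psd s (1\<^sub>m s)"
  unfolding psd_iff quad_def
  using conjugate_square_ge_0_vec[where 'a = complex] by (auto simp: less_eq_complex_def)

lemma psd_adjoint_mult: "T \<in> carrier_mat s r \<Longrightarrow> psd r (T\<^sup>\<dagger> * T)"
  using psd_congruence[OF psd_one, of T s r] by simp

lemma psd_zero: "psd s (0\<^sub>m s s)"
  using psd_adjoint_mult[of "0\<^sub>m s s" s s] by simp

text \<open>Nonnegative numbers with sum zero vanish one by one. This turns a single identity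
  between summed matrices into information about each summand.\<close>

lemma psd_mat_sum_eq_0:
  assumes "\<And>j. j \<in> J \<Longrightarrow> psd s (A j)" "finite J" "mat_sum s A J = 0\<^sub>m s s" "k \<in> J" "v \<in> carrier_vec s"
  shows "Re (quad (A k) v) = 0"
proof -
  have "quad (0\<^sub>m s s) v = 0" using assms(5) by (simp add: quad_sum[of _ s])
  then have "(\<Sum>j\<in>J. Re (quad (A j) v)) = 0"
    using quad_mat_sum[of J A s v] assms psd_carrier by (simp flip: Re_sum)
  then show ?thesis
    using assms by (subst (asm) sum_nonneg_eq_0_iff) (auto simp: psd_iff)
qed

lemma index_adjoint_mult_self:
  assumes "R \<in> carrier_mat r s" "j < s"
  shows "(R\<^sup>\<dagger> * R) $$ (j, j) = complex_of_real (\<Sum>l<r. (cmod (R $$ (l, j)))\<^sup>2)"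
proof -
  have "(R\<^sup>\<dagger> * R) $$ (j, j) = (\<Sum>l<r. cnj (R $$ (l, j)) * R $$ (l, j))"
    using assms by (auto simp: index_mult_sum simp del: index_mult_mat(1))
  also have "\<dots> = (\<Sum>l<r. complex_of_real ((cmod (R $$ (l, j)))\<^sup>2))"
    by (intro sum.cong refl) (metis complex_norm_square mult.commute)
  finally show ?thesis by simp
qed

lemma quad_unit_vec:
  assumes "A \<in> carrier_mat s s" "j < s"
  shows "quad A (unit_vec s j) = A $$ (j, j)"
proof -
  have "quad A (unit_vec s j) = (\<Sum>k<s. \<Sum>l<s. A $$ (k, l) * unit_vec s j $ l * cnj (unit_vec s j $ k))"
    using assms by (intro quad_sum) auto
  also have "\<dots> = (\<Sum>k<s. \<Sum>l<s. if l = j then if k = j then A $$ (k, l) else 0 else 0)"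
    using assms by (intro sum.cong refl) (auto simp: unit_vec_def)
  also have "\<dots> = A $$ (j, j)"
    using assms by simp
  finally show ?thesis .
qed

text \<open>At the unit vector e_j the form is the squared norm of column j of
  \<open>R\<close>.\<close>

lemma adjoint_mult_quad_eq_0:
  assumes R: "R \<in> carrier_mat r s" and "\<And>v. v \<in> carrier_vec s \<Longrightarrow> Re (quad (R\<^sup>\<dagger> * R) v) = 0"
  shows "R = 0\<^sub>m r s"
proof (rule eq_matI)
  fix i j assume "i < dim_row (0\<^sub>m r s)" "j < dim_col (0\<^sub>m r s)"
  then have ij: "i < r" "j < s" by auto
  have "quad (R\<^sup>\<dagger> * R) (unit_vec s j) = complex_of_real (\<Sum>l<r. (cmod (R $$ (l, j)))\<^sup>2)"
    using quad_unit_vec[OF mult_carrier_mat[OF adjoint_carrier[OF R] R] ij(2)]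
    unfolding index_adjoint_mult_self[OF R ij(2)] .
  then have "(\<Sum>l<r. (cmod (R $$ (l, j)))\<^sup>2) = 0"
    using assms(2)[of "unit_vec s j"] by (metis Re_complex_of_real unit_vec_carrier)
  then show "R $$ (i, j) = 0\<^sub>m r s $$ (i, j)"
    using ij by (simp add: sum_nonneg_eq_0_iff)
qed (use R in auto)

section \<open>Finite sums of matrices under linear operations and two-sided products\<close>

lemma mat_sum_cong: "(\<And>j. j \<in> J \<Longrightarrow> A j = B j) \<Longrightarrow> mat_sum s A J = mat_sum s B J"
  by (auto simp: mat_sum_def)

lemma mat_sum_add:
  assumes "\<And>j. j \<in> J \<Longrightarrow> B j \<in> carrier_mat s s"
  shows "mat_sum s (\<lambda>j. A j + B j) J = mat_sum s A J + mat_sum s B J"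
  by (rule eq_matI) (auto simp: carrier_matD[OF assms] sum.distrib)

lemma mat_sum_minus:
  assumes "\<And>j. j \<in> J \<Longrightarrow> B j \<in> carrier_mat s s"
  shows "mat_sum s (\<lambda>j. A j - B j) J = mat_sum s A J - mat_sum s B J"
  by (rule eq_matI) (auto simp: carrier_matD[OF assms] sum_subtractf)

lemma mat_sum_delta:
  "finite J \<Longrightarrow> k \<in> J \<Longrightarrow> A \<in> carrier_mat s s \<Longrightarrow>
   mat_sum s (\<lambda>j. if j = k then A else 0\<^sub>m s s) J = A"
  by (rule eq_matI) (auto simp: if_distrib[of "\<lambda>M. M $$ _"] cong: if_cong)

lemma mat_sum_singleton: "A k \<in> carrier_mat s s \<Longrightarrow> mat_sum s A {k} = A k"
  by (rule eq_matI) auto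

lemma index_mult3:
  assumes "A \<in> carrier_mat r s" "M \<in> carrier_mat s t" "B \<in> carrier_mat t u" "i < r" "j < u"
  shows "(A * M * B) $$ (i, j) = (\<Sum>l<t. \<Sum>k<s. A $$ (i, k) * M $$ (k, l) * B $$ (l, j))"
proof -
  have "(A * M * B) $$ (i, j) = (\<Sum>l<t. (A * M) $$ (i, l) * B $$ (l, j))"
    using assms by (subst index_mult_sum) auto
  also have "\<dots> = (\<Sum>l<t. \<Sum>k<s. A $$ (i, k) * M $$ (k, l) * B $$ (l, j))"
    using assms by (intro sum.cong refl) (simp add: index_mult_sum sum_distrib_right del: index_mult_mat(1))
  finally show ?thesis .
qed

text \<open>Pulling a sum out of a sandwich is the only product rule for sums used below; one-sided
  products are padded with a factor \<open>1\<^sub>m s\<close> to fit this shape.\<close>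

lemma mat_sum_mult:
  assumes "A \<in> carrier_mat r s" "B \<in> carrier_mat s r" "\<And>k. k \<in> J \<Longrightarrow> f k \<in> carrier_mat s s"
  shows "A * mat_sum s f J * B = mat_sum r (\<lambda>k. A * f k * B) J"
proof (rule eq_matI)
  fix i j assume "i < dim_row (mat_sum r (\<lambda>k. A * f k * B) J)" "j < dim_col (mat_sum r (\<lambda>k. A * f k * B) J)"
  then have ij: "i < r" "j < r" by auto
  have "(A * mat_sum s f J * B) $$ (i, j) = (\<Sum>l<s. \<Sum>k<s. \<Sum>a\<in>J. A $$ (i, k) * f a $$ (k, l) * B $$ (l, j))"
    using assms ij by (subst index_mult3[of _ r s _ s _ r])
      (auto simp: sum_distrib_left sum_distrib_right intro!: sum.cong)
  also have "\<dots> = (\<Sum>a\<in>J. \<Sum>l<s. \<Sum>k<s. A $$ (i, k) * f a $$ (k, l) * B $$ (l, j))"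
    by (simp add: sum.swap[of _ J])
  also have "\<dots> = mat_sum r (\<lambda>k. A * f k * B) J $$ (i, j)"
    using assms ij by (auto simp: index_mult3[of _ r s _ s _ r] simp del: index_mult_mat(1) intro!: sum.cong)
  finally show "(A * mat_sum s f J * B) $$ (i, j) = mat_sum r (\<lambda>k. A * f k * B) J $$ (i, j)" .
qed (use assms in auto)

text \<open>Y - Y^2 = (1 - Y) Y (1 - Y) + Y (1 - Y) Y is a sum of two congruences, so no square root
  of Y is required.\<close>

lemma psd_minus_square:
  assumes "psd s Y" "psd s (1\<^sub>m s - Y)"
  shows "psd s (Y - Y * Y)"
proof -
  have Y: "Y \<in> carrier_mat s s" "Y\<^sup>\<dagger> = Y" using assms by (auto simp: psd_iff)
  note d = carrier_matD[OF Y(1)]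
  have "psd s ((1\<^sub>m s - Y)\<^sup>\<dagger> * Y * (1\<^sub>m s - Y) + Y\<^sup>\<dagger> * (1\<^sub>m s - Y) * Y)"
    using assms Y by (intro psd_add psd_congruence) auto
  also have "(1\<^sub>m s - Y)\<^sup>\<dagger> * Y * (1\<^sub>m s - Y) + Y\<^sup>\<dagger> * (1\<^sub>m s - Y) * Y = Y - Y * Y"
    by (rule eq_matI) (auto simp: d Y adjoint_simps mat_ring_dim simp del: index_mult_mat(1))
  finally show ?thesis .
qed

text \<open>The defects \<open>Y V - V P\<close> vanish because the sum of their squares is at most
  \<open>P - P P - P P + P P = 0\<close>, by \<open>Y Y \<le> Y\<close>.\<close>

lemma projection_intertwine:
  assumes P: "projection s P" and J: "finite J"
    and Y: "\<And>j. j \<in> J \<Longrightarrow> psd d (Y j)" "\<And>j. j \<in> J \<Longrightarrow> psd d (1\<^sub>m d - Y j)"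
    and V: "\<And>j. j \<in> J \<Longrightarrow> V j \<in> carrier_mat d s"
    and one: "mat_sum s (\<lambda>j. (V j)\<^sup>\<dagger> * V j) J = 1\<^sub>m s"
    and sumP: "mat_sum s (\<lambda>j. (V j)\<^sup>\<dagger> * Y j * V j) J = P"
    and k: "k \<in> J"
  shows "Y k * V k = V k * P"
proof -
  have Pc: "P \<in> carrier_mat s s" "P\<^sup>\<dagger> = P" "P * P = P" using P by (auto simp: projection_def Her_def)
  have Yc: "Y j \<in> carrier_mat d d" "(Y j)\<^sup>\<dagger> = Y j" if "j \<in> J" for j using Y(1)[OF that] by (auto simp: psd_iff)
  define R where "R j = Y j * V j - V j * P" for j
  define M where "M j = (V j)\<^sup>\<dagger> * Y j * V j" for j
  define N where "N j = (V j)\<^sup>\<dagger> * V j" for j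
  define C where "C j = (R j)\<^sup>\<dagger> * R j" for j
  \<comment> \<open>Adding \<open>D j\<close> replaces the quadratic term in \<open>C j\<close> by a
    linear one. Thus \<open>C j + D j\<close> involves only \<open>M j\<close> and
    \<open>N j\<close>, whose sums over \<open>J\<close> are \<open>P\<close> and the
    identity.\<close>
  define D where "D j = (V j)\<^sup>\<dagger> * (Y j - Y j * Y j) * V j" for j
  have Rc: "R j \<in> carrier_mat d s" if "j \<in> J" for j using V[OF that] Pc Yc[OF that] by (auto simp: R_def)
  have Mc: "M j \<in> carrier_mat s s" and Nc: "N j \<in> carrier_mat s s" if "j \<in> J" for j
    using V[OF that] by (auto simp: M_def N_def)
  have Cp: "psd s (C j)" if "j \<in> J" for j
    using Rc[OF that] by (auto simp: C_def intro!: psd_adjoint_mult)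
  have Dp: "psd s (D j)" if "j \<in> J" for j
    using V[OF that] Y that by (auto simp: D_def intro!: psd_congruence psd_minus_square)
  have CD: "C j + D j = M j - 1\<^sub>m s * M j * P - P * M j * 1\<^sub>m s + P * N j * P" if "j \<in> J" for j
    using carrier_matD[OF V[OF that]] carrier_matD[OF Pc(1)] carrier_matD[OF Yc(1)[OF that]] Yc(2)[OF that] Pc(2)
    by (intro eq_matI) (auto simp: C_def D_def M_def N_def R_def adjoint_simps mat_ring_dim simp del: index_mult_mat(1))
  have "mat_sum s (\<lambda>j. C j + D j) J = mat_sum s (\<lambda>j. M j - 1\<^sub>m s * M j * P - P * M j * 1\<^sub>m s + P * N j * P) J"
    by (rule mat_sum_cong) (rule CD)
  also have "\<dots> = mat_sum s M J - mat_sum s (\<lambda>j. 1\<^sub>m s * M j * P) J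
      - mat_sum s (\<lambda>j. P * M j * 1\<^sub>m s) J + mat_sum s (\<lambda>j. P * N j * P) J"
    using Pc Mc Nc by (subst mat_sum_add mat_sum_minus; auto)+
  also have "\<dots> = mat_sum s M J - 1\<^sub>m s * mat_sum s M J * P - P * mat_sum s M J * 1\<^sub>m s + P * mat_sum s N J * P"
    using Pc Mc Nc by (intro arg_cong2[where f = "(+)"] arg_cong2[where f = "(-)"] refl mat_sum_mult[symmetric]) auto
  also have "mat_sum s M J = P" using sumP unfolding M_def[abs_def] .
  also have "mat_sum s N J = 1\<^sub>m s" using one unfolding N_def[abs_def] .
  also have "P - 1\<^sub>m s * P * P - P * P * 1\<^sub>m s + P * 1\<^sub>m s * P = 0\<^sub>m s s"
    using Pc by (intro eq_matI) auto
  finally have 0: "mat_sum s (\<lambda>j. C j + D j) J = 0\<^sub>m s s" .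
  have "R k = 0\<^sub>m d s"
  proof (rule adjoint_mult_quad_eq_0[OF Rc[OF k]])
    fix v :: "complex vec" assume v: "v \<in> carrier_vec s"
    have "Re (quad (C k + D k) v) = 0"
      using psd_mat_sum_eq_0[of J s "\<lambda>j. C j + D j"] 0 k v J Cp Dp by (simp add: psd_add)
    moreover have "quad (C k + D k) v = quad (C k) v + quad (D k) v"
      using quad_add[OF _ _ v] Cp Dp k by (auto simp: psd_iff)
    moreover have "0 \<le> Re (quad (C k) v)" "0 \<le> Re (quad (D k) v)"
      using Cp[OF k] Dp[OF k] v by (auto simp: psd_iff)
    ultimately show "Re (quad ((R k)\<^sup>\<dagger> * R k) v) = 0" by (simp add: C_def)
  qed
  then have "R k $$ (i, j) = 0" if "i < d" "j < s" for i j using that by simp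
  then show ?thesis
    using V[OF k] Yc(1)[OF k] Pc unfolding R_def
    by (intro eq_matI) (auto simp del: index_mult_mat(1))
qed

subsection \<open>Operator-valued measures\<close>

lemma povm_nth: "povm n s E \<Longrightarrow> i < n \<Longrightarrow> psd s (E ! i)"
  and povm_length: "povm n s E \<Longrightarrow> length E = n"
  and povm_sum: "povm n s E \<Longrightarrow> mat_sum s (\<lambda>i. E ! i) {..<n} = 1\<^sub>m s"
  by (auto simp: povm_def)

text \<open>The complement of one effect is the sum of the others. This supplies the upper bound
  that \<open>projection_intertwine\<close> requires.\<close>

lemma povm_complement:
  assumes "povm n s E" "i < n"
  shows "psd s (1\<^sub>m s - E ! i)"
proof -
  have c: "E ! j \<in> carrier_mat s s" if "j < n" for j using povm_nth[OF assms(1) that] by (rule psd_carrier)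
  have "1\<^sub>m s - E ! i = mat_sum s (\<lambda>i. E ! i) ({..<n} - {i})"
    unfolding povm_sum[OF assms(1), symmetric]
    using assms(2) c[OF assms(2)] by (intro eq_matI) (auto simp: sum_diff1)
  then show ?thesis
    using povm_nth[OF assms(1)] by (auto intro!: psd_mat_sum)
qed

lemma B_ph_length: "X \<in> B_ph p q s \<Longrightarrow> length X = p + q"
  by (auto simp: B_ph_def povm_def)

lemma B_ph_nth:
  assumes "X \<in> B_ph p q s" "i < p + q"
  shows "psd s (X ! i)" "psd s (1\<^sub>m s - X ! i)"
proof -
  obtain E F where X: "X = E @ F" "povm p s E" "povm q s F" using assms(1) by (auto simp: B_ph_def)
  then have "psd s (X ! i) \<and> psd s (1\<^sub>m s - X ! i)"
    using assms(2) povm_nth povm_complement by (auto simp: nth_append povm_length)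
  then show "psd s (X ! i)" "psd s (1\<^sub>m s - X ! i)" by auto
qed

lemma pvm_pair_nth:
  assumes "pvm p s E" "pvm q s F" "i < p + q"
  shows "projection s ((E @ F) ! i)"
  using assms by (auto simp: pvm_def povm_length nth_append)

lemma pvm_pair_B_ph: "pvm p s E \<Longrightarrow> pvm q s F \<Longrightarrow> E @ F \<in> B_ph p q s"
  by (auto simp: B_ph_def pvm_def)

subsection \<open>Rigidity of pairs of projection-valued measures\<close>

definition incl_mat :: "nat \<Rightarrow> nat \<Rightarrow> complex mat" where
  "incl_mat s r = mat (s + r) s (\<lambda>(i, j). if i = j then 1 else 0)"

lemma incl_mat_carrier [simp]: "incl_mat s r \<in> carrier_mat (s + r) s"
  and dim_incl_mat [simp]: "dim_row (incl_mat s r) = s + r" "dim_col (incl_mat s r) = s"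
  by (auto simp: incl_mat_def)

lemma index_mult_incl:
  assumes "A \<in> carrier_mat m (s + r)" "i < m" "j < s"
  shows "(A * incl_mat s r) $$ (i, j) = A $$ (i, j)"
  using assms by (simp add: index_mult_sum del: index_mult_mat(1))
    (simp add: incl_mat_def if_distrib[of "\<lambda>x. _ * x"] cong: if_cong)

lemma index_incl_mult:
  assumes "A \<in> carrier_mat s m" "i < s + r" "j < m"
  shows "(incl_mat s r * A) $$ (i, j) = (if i < s then A $$ (i, j) else 0)"
  using assms by (simp add: index_mult_sum del: index_mult_mat(1))
    (simp add: incl_mat_def if_distrib[of "\<lambda>x. x * _"] cong: if_cong)

lemma index_incl_adjoint_mult:
  assumes "A \<in> carrier_mat (s + r) m" "i < s" "j < m"
  shows "((incl_mat s r)\<^sup>\<dagger> * A) $$ (i, j) = A $$ (i, j)"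
  using assms by (simp add: index_mult_sum del: index_mult_mat(1))
    (simp add: incl_mat_def if_distrib[of "\<lambda>x. x * _"] if_distrib[of cnj] cong: if_cong)

lemma incl_isometry: "(incl_mat s r)\<^sup>\<dagger> * incl_mat s r = 1\<^sub>m s"
  by (rule eq_matI) (auto simp: index_incl_adjoint_mult[of _ s r s] simp del: index_mult_mat(1), simp_all add: incl_mat_def)

lemma compress_four_block:
  assumes "A \<in> carrier_mat s s" "B \<in> carrier_mat s r" "C \<in> carrier_mat r s" "D \<in> carrier_mat r r"
  shows "(incl_mat s r)\<^sup>\<dagger> * four_block_mat A B C D * incl_mat s r = A"
proof -
  have c: "four_block_mat A B C D \<in> carrier_mat (s + r) (s + r)" using assms by auto
  then have c': "(incl_mat s r)\<^sup>\<dagger> * four_block_mat A B C D \<in> carrier_mat s (s + r)"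
    by (intro mult_carrier_mat[of _ s "s + r"]) auto
  show ?thesis
    using assms c c' by (intro eq_matI)
      (auto simp: index_mult_incl[OF c'] index_incl_adjoint_mult[OF c] simp del: index_mult_mat(1))
qed

lemma pvm_pair_arveson:
  assumes "pvm p s E" "pvm q s F"
  shows "arveson_boundary_point (B_ph p q) s (E @ F)"
  unfolding arveson_boundary_point_def
proof (intro conjI allI impI ballI)
  show "E @ F \<in> B_ph p q s" using assms by (rule pvm_pair_B_ph)
  fix r X' \<beta> \<gamma> i
  let ?X = "E @ F"
  assume X': "X' \<in> B_ph p q (s + r)" and i: "i < length ?X"
    and *: "length X' = length ?X \<and> (\<forall>i<length ?X. \<beta> i \<in> carrier_mat s r \<and> \<gamma> i \<in> carrier_mat r r \<and>
           X' ! i = four_block_mat (?X ! i) (\<beta> i) ((\<beta> i)\<^sup>\<dagger>) (\<gamma> i))"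
  have i': "i < p + q" using i * B_ph_length[OF X'] by simp
  have P: "projection s (?X ! i)" using assms i' by (rule pvm_pair_nth)
  then have Pc: "?X ! i \<in> carrier_mat s s" by (auto simp: projection_def Her_def)
  have b: "\<beta> i \<in> carrier_mat s r" "\<gamma> i \<in> carrier_mat r r"
    and eq: "X' ! i = four_block_mat (?X ! i) (\<beta> i) ((\<beta> i)\<^sup>\<dagger>) (\<gamma> i)" using * i by auto
  have c: "(incl_mat s r)\<^sup>\<dagger> * X' ! i * incl_mat s r = ?X ! i"
    unfolding eq using Pc b by (intro compress_four_block) auto
  have "X' ! i * incl_mat s r = incl_mat s r * ?X ! i"
    using projection_intertwine[of s "?X ! i" "{0 :: nat}" "s + r" "\<lambda>_. X' ! i" "\<lambda>_. incl_mat s r" 0]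
      P B_ph_nth[OF X' i'] c Pc by (simp add: mat_sum_singleton incl_isometry)
  moreover have "X' ! i \<in> carrier_mat (s + r) (s + r)" using B_ph_nth[OF X' i'] by (simp add: psd_iff)
  \<comment> \<open>The rows of \<open>incl_mat s r * _\<close> below row \<open>s\<close> vanish,
    while those of \<open>X' ! i * incl_mat s r\<close> are the lower left block of
    \<open>X' ! i\<close>, the adjoint of \<open>\<beta> i\<close>.\<close>
  ultimately have 0: "X' ! i $$ (s + b, a) = 0" if "a < s" "b < r" for a b
    using index_mult_incl[of "X' ! i" "s + r" s r "s + b" a] index_incl_mult[of "?X ! i" s s "s + b" r a] Pc that
    by simp
  show "\<beta> i = 0\<^sub>m s r"
  proof (rule eq_matI)
    fix a b' assume "a < dim_row (0\<^sub>m s r)" "b' < dim_col (0\<^sub>m s r)"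
    then have "a < s" "b' < r" by auto
    then have "cnj (\<beta> i $$ (a, b')) = 0"
      using 0[of a b'] b Pc by (simp add: eq)
    then show "\<beta> i $$ (a, b') = 0\<^sub>m s r $$ (a, b')" using \<open>a < s\<close> \<open>b' < r\<close> by simp
  qed (use b in auto)
qed

text \<open>Padding \<open>V\<close> with zero rows to a square matrix keeps the Gram matrix, and a
  square matrix with a zero row is singular. So the determinant of the scalar matrix, a positive
  power of \<open>c\<close>, is zero.\<close>

lemma gram_scalar_eq_0:
  assumes V: "(V :: complex mat) \<in> carrier_mat d s" and "d < s" and eq: "V\<^sup>\<dagger> * V = c \<cdot>\<^sub>m 1\<^sub>m s"
  shows "c = 0"
proof -
  define W where "W = mat s s (\<lambda>(i, j). if i < d then V $$ (i, j) else 0)"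
  have W: "W \<in> carrier_mat s s" by (simp add: W_def)
  have "W\<^sup>\<dagger> * W = V\<^sup>\<dagger> * V"
  proof (rule eq_matI)
    fix i j assume "i < dim_row (V\<^sup>\<dagger> * V)" "j < dim_col (V\<^sup>\<dagger> * V)"
    then have ij: "i < s" "j < s" using V by auto
    have "(W\<^sup>\<dagger> * W) $$ (i, j) = (\<Sum>l<s. if l < d then cnj (V $$ (l, i)) * V $$ (l, j) else 0)"
      using ij W by (subst index_mult_sum) (auto simp: W_def intro!: sum.cong)
    also have "\<dots> = (\<Sum>l<d. cnj (V $$ (l, i)) * V $$ (l, j))"
      using assms(2) by (intro sum.mono_neutral_cong_right) auto
    also have "\<dots> = (V\<^sup>\<dagger> * V) $$ (i, j)"
      using ij V by (subst index_mult_sum) auto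
    finally show "(W\<^sup>\<dagger> * W) $$ (i, j) = (V\<^sup>\<dagger> * V) $$ (i, j)" .
  qed (use V W in auto)
  \<comment> \<open>Row \<open>d\<close> of \<open>W\<close> is one of the added zero rows, so the
    adjoint kills the unit vector with index \<open>d\<close>.\<close>
  moreover have "det (W\<^sup>\<dagger>) = 0"
  proof -
    have "W\<^sup>\<dagger> *\<^sub>v unit_vec s d = 0\<^sub>v s"
      using assms(2) W by (intro eq_vecI) (auto simp: W_def)
    moreover have "unit_vec s d \<noteq> (0\<^sub>v s :: complex vec)"
      using assms(2) by (metis index_unit_vec(1) index_zero_vec(1) zero_neq_one)
    ultimately show ?thesis
      using W by (intro iffD2[OF det_0_iff_vec_prod_zero_field[of "W\<^sup>\<dagger>" s]] exI[of _ "unit_vec s d"]) auto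
  qed
  ultimately have "det (c \<cdot>\<^sub>m 1\<^sub>m s) = 0"
    using det_mult[of "W\<^sup>\<dagger>" s W] W eq by simp
  then show ?thesis by simp
qed

text \<open>This bound is used in both directions: where level 2 generates, it limits the size of
  irreducible points; where irreducible pairs of size 2d + 1 exist, it shows that level d does not
  generate.\<close>

lemma irreducible_pvm_pair_size:
  assumes EF: "pvm p s E" "pvm q s F" and irr: "irreducible_point s (E @ F)"
    and conv: "E @ F \<in> mconv (p + q) d (B_ph p q d) s" and "1 \<le> s"
  shows "s \<le> d"
proof (rule ccontr)
  assume "\<not> s \<le> d"
  let ?X = "E @ F"
  obtain m Y V where Y: "\<And>j. j < m \<Longrightarrow> Y j \<in> B_ph p q d" and V: "\<And>j. j < m \<Longrightarrow> V j \<in> carrier_mat d s"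
    and one: "mat_sum s (\<lambda>j. (V j)\<^sup>\<dagger> * V j) {..<m::nat} = 1\<^sub>m s"
    and X: "\<And>i. i < p + q \<Longrightarrow> ?X ! i = mat_sum s (\<lambda>j. (V j)\<^sup>\<dagger> * (Y j ! i) * V j) {..<m}"
    using conv unfolding mconv_def by auto
  have "(V j)\<^sup>\<dagger> * V j = 0\<^sub>m s s" if j: "j < m" for j
  proof -
    have "(V j)\<^sup>\<dagger> * V j * B = B * ((V j)\<^sup>\<dagger> * V j)" if "B \<in> set ?X" for B
    proof -
      have "length ?X = p + q" using EF by (auto simp: pvm_def povm_length)
      then obtain i where i: "i < p + q" "B = ?X ! i" using \<open>B \<in> set ?X\<close> unfolding in_set_conv_nth by metis
      have B: "projection s B" unfolding i(2) using EF i(1) by (rule pvm_pair_nth)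
      then have Bc: "B \<in> carrier_mat s s" "B\<^sup>\<dagger> = B" by (auto simp: projection_def Her_def)
      have Yc: "Y j ! i \<in> carrier_mat d d" "(Y j ! i)\<^sup>\<dagger> = Y j ! i"
        using B_ph_nth(1)[OF Y[OF j] i(1)] by (auto simp: psd_iff)
      have YV: "Y j ! i * V j = V j * B"
        by (rule projection_intertwine[OF B, of "{..<m}" d "\<lambda>j. Y j ! i"])
          (use B_ph_nth[OF Y i(1)] V one X[OF i(1)] i(2) j in auto)
      \<comment> \<open>\<open>B\<close> enters on the right through Y V = V B. Since Y and
        \<open>B\<close> are Hermitian, the adjoint V^* Y = B V^* brings it out on the left.\<close>
      have "(V j)\<^sup>\<dagger> * V j * B = (V j)\<^sup>\<dagger> * (Y j ! i * V j)"
        using V[OF j] Bc by (simp add: YV mat_ring_dim)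
      also have "\<dots> = (Y j ! i * V j)\<^sup>\<dagger> * V j"
        using V[OF j] Yc by (simp add: mat_ring_dim adjoint_simps)
      also have "\<dots> = B * ((V j)\<^sup>\<dagger> * V j)"
        unfolding YV using V[OF j] Bc by (simp add: mat_ring_dim adjoint_simps)
      finally show ?thesis .
    qed
    then obtain c where c: "(V j)\<^sup>\<dagger> * V j = c \<cdot>\<^sub>m 1\<^sub>m s"
      using irr V[OF j] unfolding irreducible_point_def by (metis adjoint_carrier mult_carrier_mat)
    then have "c = 0" using gram_scalar_eq_0[OF V[OF j] _ c] \<open>\<not> s \<le> d\<close> by simp
    with c have "(V j)\<^sup>\<dagger> * V j = 0 \<cdot>\<^sub>m 1\<^sub>m s" by simp
    also have "\<dots> = 0\<^sub>m s s" by (rule eq_matI) auto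
    finally show ?thesis .
  qed
  \<comment> \<open>All summands are zero although they add up to the identity; for
    \<open>1 \<le> s\<close> the entry (0, 0) exists and exposes the contradiction.\<close>
  then have "mat_sum s (\<lambda>j. (V j)\<^sup>\<dagger> * V j) {..<m} $$ (0, 0) = 0"
    using \<open>1 \<le> s\<close> by (subst index_mat_sum) simp_all
  then show False unfolding one using \<open>1 \<le> s\<close> by simp
qed

subsection \<open>Dilating a positive-operator-valued measure\<close>

lemma psd_diag_block:
  assumes A: "psd s A" and D: "psd r D"
  shows "psd (s + r) (four_block_mat A (0\<^sub>m s r) (0\<^sub>m r s) D)"
proof -
  have c: "A \<in> carrier_mat s s" "D \<in> carrier_mat r r" "A\<^sup>\<dagger> = A" "D\<^sup>\<dagger> = D"
    using A D by (auto simp: psd_iff)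
  have "0 \<le> Re (quad (four_block_mat A (0\<^sub>m s r) (0\<^sub>m r s) D) v)" if v: "v \<in> carrier_vec (s + r)" for v
  proof -
    define a where "a = vec_first v s"
    define d where "d = vec_last v r"
    have ad: "a \<in> carrier_vec s" "d \<in> carrier_vec r" and v_eq: "v = a @\<^sub>v d"
      using v by (auto simp: a_def d_def)
    have cv: "conjugate v = conjugate a @\<^sub>v conjugate d"
      unfolding v_eq by (rule eq_vecI) auto
    have "quad (four_block_mat A (0\<^sub>m s r) (0\<^sub>m r s) D) v = quad A a + quad D d"
      unfolding quad_def cv unfolding v_eq mult_mat_vec_split[OF c(1,2) ad]
      using c ad by (intro scalar_prod_append[of _ s _ r]) auto
    then show ?thesis using A D ad by (simp add: psd_iff)
  qed
  then show ?thesis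
    using c adjoint_four_block[OF c(1) zero_carrier_mat zero_carrier_mat c(2)] by (simp add: psd_iff)
qed

lemma mat_sum_four_block:
  assumes "\<And>j. j \<in> J \<Longrightarrow> A j \<in> carrier_mat s s" "\<And>j. j \<in> J \<Longrightarrow> D j \<in> carrier_mat s s"
  shows "mat_sum (s + s) (\<lambda>j. four_block_mat (A j) (B j) (C j) (D j)) J =
    four_block_mat (mat_sum s A J) (mat_sum s B J) (mat_sum s C J) (mat_sum s D J)"
  by (rule eq_matI) (auto simp: carrier_matD[OF assms(1)] carrier_matD[OF assms(2)])

text \<open>Each block matrix is T^* diag(E_i, G_i) T, where T is unipotent with off-diagonal block
  x_i: a Schur complement read backwards, with G_i the freely chosen complement. The hypotheses
  \<open>0\<close> and \<open>1\<close> say that the off-diagonal blocks cancel and that the lower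
  right blocks sum to the identity.\<close>

lemma povm_block_dilation:
  assumes E: "povm n s E" and x: "\<And>i. i < n \<Longrightarrow> x i \<in> carrier_mat s s"
    and G: "\<And>i. i < n \<Longrightarrow> psd s (G i)"
    and 0: "mat_sum s (\<lambda>i. E ! i * x i) {..<n} = 0\<^sub>m s s"
    and 1: "mat_sum s (\<lambda>i. (x i)\<^sup>\<dagger> * (E ! i * x i) + G i) {..<n} = 1\<^sub>m s"
  shows "povm n (s + s) (map (\<lambda>i. four_block_mat (E ! i) (E ! i * x i) ((E ! i * x i)\<^sup>\<dagger>)
    ((x i)\<^sup>\<dagger> * (E ! i * x i) + G i)) [0..<n])"
proof -
  define X where "X i = four_block_mat (E ! i) (E ! i * x i) ((E ! i * x i)\<^sup>\<dagger>)
    ((x i)\<^sup>\<dagger> * (E ! i * x i) + G i)" for i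
  have c: "E ! i \<in> carrier_mat s s" "(E ! i)\<^sup>\<dagger> = E ! i" if "i < n" for i
    using povm_nth[OF E that] by (auto simp: psd_iff)
  have "psd (s + s) (X i)" if i: "i < n" for i
  proof -
    note ci = c[OF i] x[OF i] psd_carrier[OF G[OF i]]
    have xE: "(x i)\<^sup>\<dagger> * E ! i \<in> carrier_mat s s" using ci by auto
    define T where "T = four_block_mat (1\<^sub>m s) (x i) (0\<^sub>m s s) (1\<^sub>m s)"
    have T: "T \<in> carrier_mat (s + s) (s + s)" using ci by (simp add: T_def)
    have Tadj: "T\<^sup>\<dagger> = four_block_mat (1\<^sub>m s) (0\<^sub>m s s) ((x i)\<^sup>\<dagger>) (1\<^sub>m s)"
      unfolding T_def using ci by (subst adjoint_four_block[of _ s s _ s _ s]) auto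
    have "T\<^sup>\<dagger> * four_block_mat (E ! i) (0\<^sub>m s s) (0\<^sub>m s s) (G i) * T = X i"
      unfolding Tadj unfolding T_def X_def
      using ci xE right_add_zero_mat[OF xE] assoc_mult_mat[OF adjoint_carrier[OF ci(3)] ci(1) ci(3)]
      by (simp add: mult_four_block_mat[of _ s s _ s _ s _ _ s _ s] adjoint_mult)
    moreover have "psd (s + s) (T\<^sup>\<dagger> * four_block_mat (E ! i) (0\<^sub>m s s) (0\<^sub>m s s) (G i) * T)"
      by (rule psd_congruence[OF psd_diag_block[OF povm_nth[OF E i] G[OF i]] T])
    ultimately show ?thesis by simp
  qed
  moreover have "mat_sum (s + s) X {..<n} = 1\<^sub>m (s + s)"
  proof -
    have "mat_sum (s + s) X {..<n} = four_block_mat (mat_sum s (\<lambda>i. E ! i) {..<n})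
      (mat_sum s (\<lambda>i. E ! i * x i) {..<n}) (mat_sum s (\<lambda>i. (E ! i * x i)\<^sup>\<dagger>) {..<n})
      (mat_sum s (\<lambda>i. (x i)\<^sup>\<dagger> * (E ! i * x i) + G i) {..<n})"
      unfolding X_def[abs_def] using c x psd_carrier[OF G] by (intro mat_sum_four_block) auto
    also have "mat_sum s (\<lambda>i. (E ! i * x i)\<^sup>\<dagger>) {..<n} = (mat_sum s (\<lambda>i. E ! i * x i) {..<n})\<^sup>\<dagger>"
      by (rule eq_matI) (auto simp: carrier_matD[OF c(1)] carrier_matD[OF x] simp del: index_mult_mat(1))
    also have "four_block_mat (mat_sum s (\<lambda>i. E ! i) {..<n}) (mat_sum s (\<lambda>i. E ! i * x i) {..<n})
      ((mat_sum s (\<lambda>i. E ! i * x i) {..<n})\<^sup>\<dagger>)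
      (mat_sum s (\<lambda>i. (x i)\<^sup>\<dagger> * (E ! i * x i) + G i) {..<n}) = 1\<^sub>m (s + s)"
      unfolding 0 1 povm_sum[OF E] by (rule eq_matI) auto
    finally show ?thesis .
  qed
  moreover have "mat_sum (s + s) (\<lambda>i. map X [0..<n] ! i) {..<n} = mat_sum (s + s) X {..<n}"
    by (rule mat_sum_cong) simp
  ultimately show ?thesis
    unfolding povm_def X_def[symmetric] by simp
qed

text \<open>If \<open>E\<^sub>k\<close> is not a projection, \<open>x\<^sub>i = \<delta>\<^sub>i\<^sub>k I - E\<^sub>k\<close> gives \<open>\<Sum> E\<^sub>i x\<^sub>i = 0\<close> and
  \<open>\<Sum> x\<^sub>i\<^sup>* E\<^sub>i x\<^sub>i = E\<^sub>k - E\<^sub>k\<^sup>2\<close>, while the off-diagonal block \<open>E\<^sub>k x\<^sub>k = E\<^sub>k - E\<^sub>k\<^sup>2\<close> is not zero.\<close>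

lemma povm_nontrivial_dilation:
  assumes E: "povm n s E"
  shows "\<exists>\<beta> \<gamma>. (\<forall>i<n. \<beta> i \<in> carrier_mat s s \<and> \<gamma> i \<in> carrier_mat s s) \<and>
    povm n (s + s) (map (\<lambda>i. four_block_mat (E ! i) (\<beta> i) ((\<beta> i)\<^sup>\<dagger>) (\<gamma> i)) [0..<n]) \<and>
    (pvm n s E \<or> (\<exists>i<n. \<beta> i \<noteq> 0\<^sub>m s s))" (is "\<exists>\<beta> \<gamma>. ?Q \<beta> \<gamma>")
proof (cases "pvm n s E")
  \<comment> \<open>A projection-valued measure also has to be carried to size \<open>s + s\<close>,
    because the nonzero off-diagonal block may come from the other measure of the pair. Here
    \<open>x = 0\<close> and \<open>G = E\<close> give the direct sum of \<open>E\<close> with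
    itself.\<close>
  case True
  have c: "E ! i \<in> carrier_mat s s" if "i < n" for i
    using povm_nth[OF E that] by (rule psd_carrier)
  have a: "mat_sum s (\<lambda>i. E ! i * 0\<^sub>m s s) {..<n} = 0\<^sub>m s s"
    by (rule eq_matI) (auto simp: carrier_matD[OF c] mat_ring_dim simp del: index_mult_mat(1))
  have "mat_sum s (\<lambda>i. (0\<^sub>m s s)\<^sup>\<dagger> * (E ! i * 0\<^sub>m s s) + E ! i) {..<n} = mat_sum s (\<lambda>i. E ! i) {..<n}"
    by (intro mat_sum_cong) (simp add: mat_ring_dim carrier_matD[OF c] left_add_zero_mat[OF c])
  then have b: "mat_sum s (\<lambda>i. (0\<^sub>m s s)\<^sup>\<dagger> * (E ! i * 0\<^sub>m s s) + E ! i) {..<n} = 1\<^sub>m s"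
    using povm_sum[OF E] by simp
  have "povm n (s + s) (map (\<lambda>i. four_block_mat (E ! i) (E ! i * 0\<^sub>m s s) ((E ! i * 0\<^sub>m s s)\<^sup>\<dagger>)
      ((0\<^sub>m s s)\<^sup>\<dagger> * (E ! i * 0\<^sub>m s s) + E ! i)) [0..<n])"
    using a b by (intro povm_block_dilation[OF E]) (auto intro: povm_nth[OF E])
  moreover have "E ! i * 0\<^sub>m s s \<in> carrier_mat s s \<and> (0\<^sub>m s s)\<^sup>\<dagger> * (E ! i * 0\<^sub>m s s) + E ! i \<in> carrier_mat s s"
    if "i < n" for i using c[OF that] by auto
  ultimately have "?Q (\<lambda>i. E ! i * 0\<^sub>m s s) (\<lambda>i. (0\<^sub>m s s)\<^sup>\<dagger> * (E ! i * 0\<^sub>m s s) + E ! i)"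
    using True by fast
  then show ?thesis by (intro exI)
next
  case False
  have c: "E ! i \<in> carrier_mat s s" "(E ! i)\<^sup>\<dagger> = E ! i" if "i < n" for i
    using povm_nth[OF E that] by (auto simp: psd_iff)
  obtain k where k: "k < n" and np: "\<not> projection s (E ! k)"
    using False E by (auto simp: pvm_def)
  define P where "P = E ! k"
  have P: "P \<in> carrier_mat s s" "P\<^sup>\<dagger> = P" "P * P \<noteq> P"
    using c[OF k] np by (auto simp: P_def projection_def Her_def)
  define x where "x i = (if i = k then 1\<^sub>m s else 0\<^sub>m s s) - P" for i
  \<comment> \<open>The lower right blocks still lack 1 - P + P^2. All of it goes to outcome
    \<open>k\<close>, written as a sum of two visibly positive terms.\<close>
  define G where "G i = (if i = k then (1\<^sub>m s - P) + P\<^sup>\<dagger> * P else 0\<^sub>m s s)" for i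
  have x: "x i \<in> carrier_mat s s" for i using P by (auto simp: x_def)
  have G: "psd s (G i)" for i
    using psd_add[OF povm_complement[OF E k] psd_adjoint_mult[OF P(1)]]
    by (simp add: G_def P_def[symmetric] psd_zero)
  have "mat_sum s (\<lambda>i. E ! i * x i) {..<n} =
      mat_sum s (\<lambda>i. (if i = k then P else 0\<^sub>m s s) - 1\<^sub>m s * E ! i * P) {..<n}"
  proof (rule mat_sum_cong)
    fix i assume "i \<in> {..<n}"
    then have d: "dim_row (E ! i) = s" "dim_col (E ! i) = s" using c[of i] by auto
    show "E ! i * x i = (if i = k then P else 0\<^sub>m s s) - 1\<^sub>m s * E ! i * P"
      using d carrier_matD[OF P(1)] by (cases "i = k") (simp_all add: x_def P_def[symmetric] mat_ring_dim)
  qed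
  also have "\<dots> = mat_sum s (\<lambda>i. if i = k then P else 0\<^sub>m s s) {..<n} - mat_sum s (\<lambda>i. 1\<^sub>m s * E ! i * P) {..<n}"
    using c(1) P(1) by (intro mat_sum_minus mult_carrier_mat[of _ s s]) auto
  also have "\<dots> = P - 1\<^sub>m s * mat_sum s (\<lambda>i. E ! i) {..<n} * P"
    using c(1) P(1) k by (intro arg_cong2[where f = "(-)"] mat_sum_delta mat_sum_mult[symmetric]) auto
  also have "\<dots> = 0\<^sub>m s s"
    using P by (simp add: povm_sum[OF E])
  finally have a: "mat_sum s (\<lambda>i. E ! i * x i) {..<n} = 0\<^sub>m s s" .
  have "mat_sum s (\<lambda>i. (x i)\<^sup>\<dagger> * (E ! i * x i) + G i) {..<n} =
      mat_sum s (\<lambda>i. (if i = k then 1\<^sub>m s - P * P else 0\<^sub>m s s) + P * E ! i * P) {..<n}"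
  proof (rule mat_sum_cong)
    fix i assume "i \<in> {..<n}"
    then have d: "dim_row (E ! i) = s" "dim_col (E ! i) = s" using c[of i] by auto
    show "(x i)\<^sup>\<dagger> * (E ! i * x i) + G i = (if i = k then 1\<^sub>m s - P * P else 0\<^sub>m s s) + P * E ! i * P"
      using d carrier_matD[OF P(1)] P(2) by (intro eq_matI)
        (auto simp: x_def G_def adjoint_simps mat_ring_dim P_def[symmetric] simp del: index_mult_mat(1))
  qed
  also have "\<dots> = (1\<^sub>m s - P * P) + P * mat_sum s (\<lambda>i. E ! i) {..<n} * P"
    using c(1) P(1) k by (subst mat_sum_add) (auto intro!: arg_cong2[where f = "(+)"] mat_sum_delta mat_sum_mult[symmetric])
  also have "\<dots> = 1\<^sub>m s"
    using P by (intro eq_matI) (auto simp: povm_sum[OF E] simp del: index_mult_mat(1))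
  finally have b: "mat_sum s (\<lambda>i. (x i)\<^sup>\<dagger> * (E ! i * x i) + G i) {..<n} = 1\<^sub>m s" .
  have "E ! k * x k \<noteq> 0\<^sub>m s s"
  proof
    assume "E ! k * x k = 0\<^sub>m s s"
    then have 0: "P - P * P = 0\<^sub>m s s"
      using P by (simp add: x_def P_def[symmetric] mat_ring_dim)
    have "P * P = P - (P - P * P)" using P by (intro eq_matI) (auto simp del: index_mult_mat(1))
    also have "\<dots> = P" unfolding 0 using P by (intro eq_matI) auto
    finally show False using P by simp
  qed
  moreover have "E ! i * x i \<in> carrier_mat s s \<and> (x i)\<^sup>\<dagger> * (E ! i * x i) + G i \<in> carrier_mat s s"
    if "i < n" for i using c(1)[OF that] x[of i] psd_carrier[OF G[of i]] by auto
  ultimately have "?Q (\<lambda>i. E ! i * x i) (\<lambda>i. (x i)\<^sup>\<dagger> * (E ! i * x i) + G i)"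
    using povm_block_dilation[OF E x G a b] k by fast
  then show ?thesis by (intro exI)
qed

text \<open>The two measures are dilated separately but to the common size \<open>s + s\<close>, so
  their concatenation is a dilation of the pair with \<open>r = s\<close>, which is admissible as
  \<open>1 \<le> s\<close>. The boundary property then forces all blocks of both dilations to
  vanish.\<close>

lemma arveson_imp_pvm_pair:
  assumes "1 \<le> s" and arv: "arveson_boundary_point (B_ph p q) s X"
  shows "\<exists>E F. X = E @ F \<and> pvm p s E \<and> pvm q s F"
proof -
  obtain E F where X: "X = E @ F" and E: "povm p s E" and F: "povm q s F"
    using arv by (auto simp: arveson_boundary_point_def B_ph_def)
  obtain b1 g1 where 1: "\<forall>i<p. b1 i \<in> carrier_mat s s \<and> g1 i \<in> carrier_mat s s"
    "povm p (s + s) (map (\<lambda>i. four_block_mat (E ! i) (b1 i) ((b1 i)\<^sup>\<dagger>) (g1 i)) [0..<p])"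
    "pvm p s E \<or> (\<exists>i<p. b1 i \<noteq> 0\<^sub>m s s)"
    using povm_nontrivial_dilation[OF E] by blast
  obtain b2 g2 where 2: "\<forall>i<q. b2 i \<in> carrier_mat s s \<and> g2 i \<in> carrier_mat s s"
    "povm q (s + s) (map (\<lambda>i. four_block_mat (F ! i) (b2 i) ((b2 i)\<^sup>\<dagger>) (g2 i)) [0..<q])"
    "pvm q s F \<or> (\<exists>i<q. b2 i \<noteq> 0\<^sub>m s s)"
    using povm_nontrivial_dilation[OF F] by blast
  let ?E = "map (\<lambda>i. four_block_mat (E ! i) (b1 i) ((b1 i)\<^sup>\<dagger>) (g1 i)) [0..<p]"
  let ?F = "map (\<lambda>i. four_block_mat (F ! i) (b2 i) ((b2 i)\<^sup>\<dagger>) (g2 i)) [0..<q]"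
  define b where "b i = (if i < p then b1 i else b2 (i - p))" for i
  define g where "g i = (if i < p then g1 i else g2 (i - p))" for i
  have len: "length E = p" "length F = q" using E F by (auto simp: povm_length)
  have K: "?E @ ?F \<in> B_ph p q (s + s)" using 1(2) 2(2) by (auto simp: B_ph_def)
  have "b i \<in> carrier_mat s s \<and> g i \<in> carrier_mat s s \<and>
      (?E @ ?F) ! i = four_block_mat (X ! i) (b i) ((b i)\<^sup>\<dagger>) (g i)" if "i < p + q" for i
  proof (cases "i < p")
    case True
    then show ?thesis using 1(1) by (simp add: X len b_def g_def nth_append)
  next
    case False
    then have "i - p < q" using that by simp
    then show ?thesis using False 2(1) by (simp add: X len b_def g_def nth_append)
  qed
  then have "length (?E @ ?F) = length X \<and> (\<forall>i<length X. b i \<in> carrier_mat s s \<and> g i \<in> carrier_mat s s \<and>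
      (?E @ ?F) ! i = four_block_mat (X ! i) (b i) ((b i)\<^sup>\<dagger>) (g i))"
    by (simp add: X len)
  then have b0: "\<forall>i<length X. b i = 0\<^sub>m s s"
    using arv assms(1) K unfolding arveson_boundary_point_def by blast
  have "b1 i = 0\<^sub>m s s" if "i < p" for i
    using b0[rule_format, of i] that by (simp add: X len b_def)
  moreover have "b2 i = 0\<^sub>m s s" if "i < q" for i
    using b0[rule_format, of "p + i"] that by (simp add: X len b_def)
  ultimately show ?thesis using X 1(3) 2(3) by blast
qed

subsection \<open>Irreducible pairs of projection-valued measures of every odd size\<close>

lemma projection_psd: "projection s P \<Longrightarrow> psd s P"
  using psd_adjoint_mult[of P s s] by (auto simp: projection_def Her_def)

lemma projection_complement:
  assumes "projection s P"
  shows "projection s (1\<^sub>m s - P)"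
proof -
  have P: "P \<in> carrier_mat s s" "P\<^sup>\<dagger> = P" "P * P = P" using assms by (auto simp: projection_def Her_def)
  have "(1\<^sub>m s - P) * (1\<^sub>m s - P) = 1\<^sub>m s - P"
    using carrier_matD[OF P(1)] P(3) by (intro eq_matI) (auto simp: mat_ring_dim simp del: index_mult_mat(1))
  then show ?thesis using P by (auto simp: projection_def Her_def adjoint_simps)
qed

text \<open>Zero outcomes are projections, so a measure with two or three outcomes can stand in for
  one with any larger number.\<close>

lemma pvm_pad:
  assumes "length L \<le> n" and P: "\<And>i. i < length L \<Longrightarrow> projection s (L ! i)"
    and one: "mat_sum s (\<lambda>i. L ! i) {..<length L} = 1\<^sub>m s"
  shows "pvm n s (L @ replicate (n - length L) (0\<^sub>m s s))"
proof -
  let ?E = "L @ replicate (n - length L) (0\<^sub>m s s)"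
  have proj: "projection s (?E ! i)" if "i < n" for i
    using P[of i] that by (auto simp: nth_append projection_def Her_def)
  have "mat_sum s (\<lambda>i. ?E ! i) {..<n} = mat_sum s (\<lambda>i. L ! i) {..<length L}"
  proof (rule eq_matI)
    fix i j assume "i < dim_row (mat_sum s (\<lambda>i. L ! i) {..<length L})"
      "j < dim_col (mat_sum s (\<lambda>i. L ! i) {..<length L})"
    then show "mat_sum s (\<lambda>i. ?E ! i) {..<n} $$ (i, j) = mat_sum s (\<lambda>i. L ! i) {..<length L} $$ (i, j)"
      using assms(1) by (simp, intro sum.mono_neutral_cong_right) (auto simp: nth_append)
  qed auto
  then show ?thesis
    using assms(1) one proj projection_psd by (auto simp: pvm_def povm_def)
qed

text \<open>The projection onto the span of the vectors \<open>e\<^sub>k + e\<^sub>k\<^sub>+\<^sub>1\<close>, \<open>k = a, a + 2, \<dots>, a + 2 n - 2\<close>.\<close>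

definition block_proj :: "nat \<Rightarrow> nat \<Rightarrow> complex mat" where
  "block_proj n a = mat (2 * n + 1) (2 * n + 1) (\<lambda>(i, j).
     if a \<le> i \<and> i < a + 2 * n \<and> a \<le> j \<and> j < a + 2 * n \<and> (i - a) div 2 = (j - a) div 2 then 1 / 2 else 0)"

lemma block_proj_carrier [simp]: "block_proj n a \<in> carrier_mat (2 * n + 1) (2 * n + 1)"
  and dim_block_proj [simp]: "dim_row (block_proj n a) = 2 * n + 1" "dim_col (block_proj n a) = 2 * n + 1"
  by (auto simp: block_proj_def)

lemma projection_block_proj:
  assumes "a \<le> 1"
  shows "projection (2 * n + 1) (block_proj n a)"
proof -
  let ?M = "block_proj n a"
  have "?M * ?M = ?M"
  proof (rule eq_matI)
    fix i j assume "i < dim_row ?M" "j < dim_col ?M"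
    then have ij: "i < 2 * n + 1" "j < 2 * n + 1" by auto
    have s: "(?M * ?M) $$ (i, j) = (\<Sum>l<2 * n + 1. ?M $$ (i, l) * ?M $$ (l, j))"
      using ij by (simp add: index_mult_sum del: index_mult_mat(1))
    show "(?M * ?M) $$ (i, j) = ?M $$ (i, j)"
    proof (cases "a \<le> i \<and> i < a + 2 * n \<and> a \<le> j \<and> j < a + 2 * n \<and> (i - a) div 2 = (j - a) div 2")
      case True
      \<comment> \<open>\<open>b\<close> is the first index of the block containing
        \<open>i\<close>. Row \<open>i\<close> lives on \<open>b\<close> and \<open>b + 1\<close>,
        so the product has two terms 1/2 * 1/2 and reproduces the entry 1/2.\<close>
      define b where "b = a + 2 * ((i - a) div 2)"
      have "(i - a) div 2 < n" using True by (intro less_mult_imp_div_less) auto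
      then have b: "b + 1 < a + 2 * n" "a \<le> b" by (auto simp: b_def)
      have iff: "(i - a) div 2 = (l - a) div 2 \<longleftrightarrow> l = b \<or> l = b + 1" if "a \<le> l" for l
        using that by (auto simp: b_def)
      have "(?M * ?M) $$ (i, j) = (\<Sum>l\<in>{b, b + 1}. 1 / 4)"
        unfolding s
      proof (rule sum.mono_neutral_cong_right)
        show "{b, b + 1} \<subseteq> {..<2 * n + 1}" using b assms by auto
        have "?M $$ (i, l) = 0" if "l < 2 * n + 1" "l \<noteq> b" "l \<noteq> b + 1" for l
          using ij(1) that iff[of l] by (auto simp: block_proj_def)
        then show "\<forall>l\<in>{..<2 * n + 1} - {b, b + 1}. ?M $$ (i, l) * ?M $$ (l, j) = 0"
          by simp
        fix l assume "l \<in> {b, b + 1}"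
        then have "a \<le> l" "l < a + 2 * n" "l < 2 * n + 1" "(i - a) div 2 = (l - a) div 2"
          using b assms iff[of l] by auto
        then show "?M $$ (i, l) * ?M $$ (l, j) = 1 / 4"
          using True ij by (simp add: block_proj_def)
      qed auto
      then show ?thesis using True ij by (simp add: block_proj_def)
    next
      case False
      have "?M $$ (i, l) * ?M $$ (l, j) = 0" if "l < 2 * n + 1" for l
        using False ij that by (auto simp: block_proj_def)
      then have "(?M * ?M) $$ (i, j) = 0" unfolding s by (intro sum.neutral) blast
      then show ?thesis using False ij by (simp add: block_proj_def)
    qed
  qed auto
  moreover have "?M\<^sup>\<dagger> = ?M"
    by (rule eq_matI) (auto simp: block_proj_def)
  ultimately show ?thesis using block_proj_carrier unfolding projection_def Her_def by blast
qed

lemma index_block_proj_col: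
  assumes "a \<le> k" "even (k - a)" "k + 1 < a + 2 * n" "k + 1 < 2 * n + 1" "i < 2 * n + 1"
  shows "block_proj n a $$ (i, k) = (if i = k \<or> i = k + 1 then 1 / 2 else 0)"
proof -
  obtain m where m: "k = a + 2 * m" using assms(1,2) by (metis evenE le_add_diff_inverse)
  have "a \<le> i \<and> i < a + 2 * n \<and> (i - a) div 2 = (k - a) div 2 \<longleftrightarrow> i = k \<or> i = k + 1"
    using assms(3) unfolding m by auto
  then show ?thesis using assms by (auto simp: block_proj_def)
qed

section \<open>The rank one projection at the end of the chain\<close>

definition corner :: "nat \<Rightarrow> complex mat" where
  "corner s = mat s s (\<lambda>(i, j). if i = 0 \<and> j = 0 then 1 else 0)"

lemma corner_carrier [simp]: "corner s \<in> carrier_mat s s"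
  and dim_corner [simp]: "dim_row (corner s) = s" "dim_col (corner s) = s"
  by (auto simp: corner_def)

lemma index_mult_corner:
  assumes "A \<in> carrier_mat s s" "i < s" "j < s"
  shows "(A * corner s) $$ (i, j) = (if j = 0 then A $$ (i, 0) else 0)"
proof -
  have "(A * corner s) $$ (i, j) = (\<Sum>l<s. A $$ (i, l) * corner s $$ (l, j))"
    using assms by (subst index_mult_sum) auto
  also have "\<dots> = (\<Sum>l<s. if l = 0 then (if j = 0 then A $$ (i, 0) else 0) else 0)"
    using assms by (intro sum.cong refl) (auto simp: corner_def)
  finally have "(A * corner s) $$ (i, j) = (\<Sum>l<s. if l = 0 then (if j = 0 then A $$ (i, 0) else 0) else 0)" .
  then show ?thesis using assms by auto
qed

lemma index_corner_mult:
  assumes "A \<in> carrier_mat s s" "i < s" "j < s"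
  shows "(corner s * A) $$ (i, j) = (if i = 0 then A $$ (0, j) else 0)"
proof -
  have "(corner s * A) $$ (i, j) = (\<Sum>l<s. corner s $$ (i, l) * A $$ (l, j))"
    using assms by (subst index_mult_sum) auto
  also have "\<dots> = (\<Sum>l<s. if l = 0 then (if i = 0 then A $$ (0, j) else 0) else 0)"
    using assms by (intro sum.cong refl) (auto simp: corner_def)
  finally have "(corner s * A) $$ (i, j) = (\<Sum>l<s. if l = 0 then (if i = 0 then A $$ (0, j) else 0) else 0)" .
  then show ?thesis using assms by auto
qed

lemma projection_corner: "projection s (corner s)"
proof -
  have "corner s * corner s = corner s"
    by (rule eq_matI) (auto simp: index_mult_corner simp del: index_mult_mat(1), auto simp: corner_def)
  moreover have "(corner s)\<^sup>\<dagger> = corner s" by (rule eq_matI) (auto simp: corner_def)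
  ultimately show ?thesis by (simp add: projection_def Her_def)
qed

lemma projection_complement2:
  assumes "projection s P" "projection s R" "P * R = 0\<^sub>m s s" "R * P = 0\<^sub>m s s"
  shows "projection s (1\<^sub>m s - P - R)"
proof -
  have P: "P \<in> carrier_mat s s" "P\<^sup>\<dagger> = P" "P * P = P" and R: "R \<in> carrier_mat s s" "R\<^sup>\<dagger> = R" "R * R = R"
    using assms(1,2) by (auto simp: projection_def Her_def)
  have "(1\<^sub>m s - P - R) * (1\<^sub>m s - P - R) = 1\<^sub>m s - P - R"
    using carrier_matD[OF P(1)] carrier_matD[OF R(1)] P(3) R(3) assms(3,4)
    by (intro eq_matI) (auto simp: mat_ring_dim simp del: index_mult_mat(1))
  then show ?thesis using P R by (auto simp: projection_def Her_def adjoint_simps)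
qed

text \<open>A matrix commuting with the rank one projection has \<open>e\<^sub>0\<close> as an eigenvector, and then the two
  block projections, whose blocks overlap in a chain, pass the eigenvalue on from \<open>e\<^sub>k\<close> to \<open>e\<^sub>k\<^sub>+\<^sub>1\<close>.\<close>

lemma commutant_chain:
  assumes A: "A \<in> carrier_mat (2 * n + 1) (2 * n + 1)"
    and Q: "A * block_proj n 0 = block_proj n 0 * A"
    and P: "A * block_proj n 1 = block_proj n 1 * A"
    and R: "A * corner (2 * n + 1) = corner (2 * n + 1) * A"
  shows "A = A $$ (0, 0) \<cdot>\<^sub>m 1\<^sub>m (2 * n + 1)"
proof -
  let ?s = "2 * n + 1" and ?c = "A $$ (0, 0)"
  have col: "\<forall>i<?s. A $$ (i, k) = (if i = k then ?c else 0)" if "k < ?s" for k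
    using that
  proof (induction k)
    case 0
    show ?case
    proof (intro allI impI)
      fix i assume i: "i < ?s"
      show "A $$ (i, 0) = (if i = 0 then ?c else 0)"
        using arg_cong[OF R, of "\<lambda>M. M $$ (i, 0)"] index_mult_corner[OF A i, of 0] index_corner_mult[OF A i, of 0] by simp
    qed
  next
    case (Suc k)
    \<comment> \<open>The offset with the parity of \<open>k\<close> is the one for which
      \<open>k\<close> opens a block, so that \<open>k\<close> and \<open>k + 1\<close> are the two
      indices of that block.\<close>
    define a where "a = k mod 2"
    have a: "a \<le> k" "even (k - a)" "k + 1 < a + 2 * n" "k + 1 < ?s"
      using Suc.prems by (auto simp: a_def) presburger+
    have comm: "A * block_proj n a = block_proj n a * A"
      using P Q unfolding a_def by (cases "k mod 2 = 0") auto
    show ?case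
    proof (intro allI impI)
      fix i assume i: "i < ?s"
      have "(A * block_proj n a) $$ (i, k) = (\<Sum>l<?s. A $$ (i, l) * block_proj n a $$ (l, k))"
        using A a i by (subst index_mult_sum) auto
      also have "\<dots> = (\<Sum>l<?s. (if l = k then A $$ (i, k) / 2 else 0) + (if l = k + 1 then A $$ (i, k + 1) / 2 else 0))"
        by (intro sum.cong refl) (auto simp: index_block_proj_col[OF a])
      also have "\<dots> = (A $$ (i, k) + A $$ (i, k + 1)) / 2"
        unfolding sum.distrib using a by (simp add: add_divide_distrib)
      finally have 1: "(A * block_proj n a) $$ (i, k) = (A $$ (i, k) + A $$ (i, k + 1)) / 2" .
      \<comment> \<open>By the induction hypothesis column \<open>k\<close> of \<open>A\<close> is a
        multiple of e_k, so a single term survives. Comparing column \<open>k\<close> of the two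
        products then determines column \<open>k + 1\<close> of \<open>A\<close>.\<close>
      have "(block_proj n a * A) $$ (i, k) = (\<Sum>l<?s. block_proj n a $$ (i, l) * A $$ (l, k))"
        using A a i by (subst index_mult_sum) auto
      also have "\<dots> = (\<Sum>l<?s. if l = k then block_proj n a $$ (i, k) * ?c else 0)"
        using Suc by (intro sum.cong refl) auto
      also have "\<dots> = block_proj n a $$ (i, k) * ?c"
        using a by simp
      finally have 2: "(block_proj n a * A) $$ (i, k) = block_proj n a $$ (i, k) * ?c" .
      have "(A $$ (i, k) + A $$ (i, k + 1)) / 2 = block_proj n a $$ (i, k) * ?c"
        using 1 2 unfolding comm by (rule trans[OF sym])
      then have "A $$ (i, k) + A $$ (i, k + 1) = 2 * block_proj n a $$ (i, k) * ?c"
        by (simp add: field_simps)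
      then show "A $$ (i, Suc k) = (if i = Suc k then ?c else 0)"
        using Suc i index_block_proj_col[OF a i] by (auto split: if_splits)
    qed
  qed
  show ?thesis
  proof (rule eq_matI)
    fix i j assume "i < dim_row (?c \<cdot>\<^sub>m 1\<^sub>m ?s)" "j < dim_col (?c \<cdot>\<^sub>m 1\<^sub>m ?s)"
    then have "i < ?s" "j < ?s" by auto
    then have "A $$ (i, j) = (if i = j then ?c else 0)" using col by blast
    also have "\<dots> = (?c \<cdot>\<^sub>m 1\<^sub>m ?s) $$ (i, j)" using \<open>i < ?s\<close> \<open>j < ?s\<close> by simp
    finally show "A $$ (i, j) = (?c \<cdot>\<^sub>m 1\<^sub>m ?s) $$ (i, j)" .
  qed (use A in auto)
qed

text \<open>The blocks with offset 1 begin at index 1 and leave e_0 out. By this orthogonality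
  \<open>P\<close>, \<open>1 - P - R\<close> and \<open>R\<close> form a projection-valued measure
  with three outcomes.\<close>

lemma block_proj_corner:
  "block_proj n 1 * corner (2 * n + 1) = 0\<^sub>m (2 * n + 1) (2 * n + 1)"
  "corner (2 * n + 1) * block_proj n 1 = 0\<^sub>m (2 * n + 1) (2 * n + 1)"
proof -
  show "block_proj n 1 * corner (2 * n + 1) = 0\<^sub>m (2 * n + 1) (2 * n + 1)"
  proof (rule eq_matI)
    fix i j assume "i < dim_row (0\<^sub>m (2 * n + 1) (2 * n + 1))" "j < dim_col (0\<^sub>m (2 * n + 1) (2 * n + 1))"
    then have "i < 2 * n + 1" "j < 2 * n + 1" by auto
    then show "(block_proj n 1 * corner (2 * n + 1)) $$ (i, j) = 0\<^sub>m (2 * n + 1) (2 * n + 1) $$ (i, j)"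
      unfolding index_mult_corner[OF block_proj_carrier \<open>i < 2 * n + 1\<close> \<open>j < 2 * n + 1\<close>]
      by (simp add: block_proj_def)
  qed auto
  show "corner (2 * n + 1) * block_proj n 1 = 0\<^sub>m (2 * n + 1) (2 * n + 1)"
  proof (rule eq_matI)
    fix i j assume "i < dim_row (0\<^sub>m (2 * n + 1) (2 * n + 1))" "j < dim_col (0\<^sub>m (2 * n + 1) (2 * n + 1))"
    then have "i < 2 * n + 1" "j < 2 * n + 1" by auto
    then show "(corner (2 * n + 1) * block_proj n 1) $$ (i, j) = 0\<^sub>m (2 * n + 1) (2 * n + 1) $$ (i, j)"
      unfolding index_corner_mult[OF block_proj_carrier \<open>i < 2 * n + 1\<close> \<open>j < 2 * n + 1\<close>]
      by (simp add: block_proj_def)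
  qed auto
qed

lemma irreducible_pvm_pair_exists:
  assumes "2 \<le> p" "2 \<le> q" "3 \<le> max p q"
  obtains E F where "pvm p (2 * n + 1) E" "pvm q (2 * n + 1) F" "irreducible_point (2 * n + 1) (E @ F)"
proof -
  define s where "s = 2 * n + 1"
  define P where "P = block_proj n 1"
  define Q where "Q = block_proj n 0"
  define R where "R = corner s"
  have P: "projection s P" and Q: "projection s Q" and R: "projection s R"
    unfolding s_def P_def Q_def R_def by (intro projection_block_proj projection_corner; simp)+
  then have c: "P \<in> carrier_mat s s" "Q \<in> carrier_mat s s" "R \<in> carrier_mat s s"
    by (auto simp: projection_def Her_def)
  define L where "L = [P, 1\<^sub>m s - P - R, R]"
  define M where "M = [Q, 1\<^sub>m s - Q]"
  have L: "pvm k s (L @ replicate (k - length L) (0\<^sub>m s s))" if "3 \<le> k" for k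
  proof (rule pvm_pad)
    have "projection s (1\<^sub>m s - P - R)"
      by (rule projection_complement2[OF P R]) (unfold P_def R_def s_def, (rule block_proj_corner)+)
    then show "projection s (L ! i)" if "i < length L" for i
      using that P R by (auto simp: L_def less_Suc_eq)
    show "mat_sum s (\<lambda>i. L ! i) {..<length L} = 1\<^sub>m s"
      using c by (intro eq_matI) (auto simp: L_def)
  qed (use that in \<open>simp add: L_def\<close>)
  have M: "pvm k s (M @ replicate (k - length M) (0\<^sub>m s s))" if "2 \<le> k" for k
  proof (rule pvm_pad)
    show "projection s (M ! i)" if "i < length M" for i
      using that Q projection_complement[OF Q] by (auto simp: M_def less_Suc_eq)
    show "mat_sum s (\<lambda>i. M ! i) {..<length M} = 1\<^sub>m s"
      using c by (intro eq_matI) (auto simp: M_def)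
  qed (use that in \<open>simp add: M_def\<close>)
  \<comment> \<open>Irreducibility depends only on the set of entries. Stated for every
    \<open>X\<close> containing the three projections, it covers both cases, the three outcomes
    sitting in the first or in the second measure.\<close>
  have irr: "irreducible_point s X" if "{P, Q, R} \<subseteq> set X" for X
    unfolding irreducible_point_def
  proof (intro ballI impI)
    fix A assume "A \<in> carrier_mat s s" "\<forall>B\<in>set X. A * B = B * A"
    then have "A = A $$ (0, 0) \<cdot>\<^sub>m 1\<^sub>m s"
      using that unfolding s_def P_def Q_def R_def by (intro commutant_chain) auto
    then show "\<exists>c. A = c \<cdot>\<^sub>m 1\<^sub>m s" by blast
  qed
  show thesis
  proof (cases "3 \<le> p")
    case True
    show thesis
      by (rule that[unfolded s_def[symmetric], OF L[OF True] M[OF assms(2)]], rule irr) (auto simp: L_def M_def)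
  next
    case False
    then have "3 \<le> q" using assms(3) by simp
    show thesis
      by (rule that[unfolded s_def[symmetric], OF M[OF assms(1)] L[OF \<open>3 \<le> q\<close>]], rule irr) (auto simp: L_def M_def)
  qed
qed

subsection \<open>Unitary diagonalization of normal matrices\<close>

definition diag_of :: "nat \<Rightarrow> (nat \<Rightarrow> complex) \<Rightarrow> complex mat" where
  "diag_of n d = mat n n (\<lambda>(i, j). if i = j then d i else 0)"

lemma diag_of_carrier [simp]: "diag_of n d \<in> carrier_mat n n"
  and dim_diag_of [simp]: "dim_row (diag_of n d) = n" "dim_col (diag_of n d) = n"
  and index_diag_of [simp]: "i < n \<Longrightarrow> j < n \<Longrightarrow> diag_of n d $$ (i, j) = (if i = j then d i else 0)"
  by (auto simp: diag_of_def)

lemma adjoint_diag_of: "(diag_of n d)\<^sup>\<dagger> = diag_of n (\<lambda>i. cnj (d i))"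
  by (rule eq_matI) auto

lemma index_mult_diag_of:
  assumes "A \<in> carrier_mat m n" "i < m" "j < n"
  shows "(A * diag_of n d) $$ (i, j) = A $$ (i, j) * d j"
proof -
  have "(A * diag_of n d) $$ (i, j) = (\<Sum>l<n. A $$ (i, l) * diag_of n d $$ (l, j))"
    using assms by (subst index_mult_sum) auto
  also have "\<dots> = (\<Sum>l<n. if l = j then A $$ (i, j) * d j else 0)"
    using assms by (intro sum.cong refl) auto
  finally show ?thesis using assms by simp
qed

lemma mult_diag_of: "diag_of n d * diag_of n e = diag_of n (\<lambda>i. d i * e i)"
  by (rule eq_matI) (auto simp: index_mult_diag_of[of _ n] simp del: index_mult_mat(1))

text \<open>The reflection along \<open>v + e\<^sub>0\<close>: choosing the sign that makes \<open>v\<^sub>0 \<ge> 0\<close> keeps this vector away from 0.\<close>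

lemma householder:
  fixes v :: "complex vec"
  assumes n: "0 < n" and v: "v \<in> carrier_vec n"
    and unit: "(\<Sum>i<n. (cmod (v $ i))\<^sup>2) = 1" and v0: "v $ 0 = complex_of_real t" "0 \<le> t"
  shows "\<exists>H\<in>carrier_mat n n. H\<^sup>\<dagger> = H \<and> H * H = 1\<^sub>m n \<and> (\<forall>i<n. H $$ (i, 0) = - v $ i)"
proof -
  define u where "u i = v $ i + (if i = 0 then 1 else 0)" for i
  define U where "U = mat n 1 (\<lambda>(i, j). u i)"
  have U: "U \<in> carrier_mat n 1" by (simp add: U_def)
  \<comment> \<open>The vector u = v + e_0 has squared norm 2 (1 + t), so 1 / (1 + t) is the usual
    reflection coefficient 2 / |u|^2.\<close>
  define c where "c = complex_of_real (1 / (1 + t))"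
  have c: "cnj c = c" "c * (1 + complex_of_real t) = 1"
  proof -
    show "cnj c = c" by (simp add: c_def)
    have "c * (1 + complex_of_real t) = complex_of_real (1 / (1 + t) * (1 + t))"
      unfolding c_def of_real_mult by simp
    then show "c * (1 + complex_of_real t) = 1" using v0(2) by simp
  qed
  have UU: "U\<^sup>\<dagger> * U = (2 * (1 + complex_of_real t)) \<cdot>\<^sub>m 1\<^sub>m 1"
  proof -
    have "(\<Sum>i<n. cnj (u i) * u i) = (\<Sum>i<n. complex_of_real ((cmod (v $ i))\<^sup>2) + (if i = 0 then 2 * complex_of_real t + 1 else 0))"
    proof (intro sum.cong refl)
      fix i assume "i \<in> {..<n}"
      have "cnj (v $ i) * v $ i = complex_of_real ((cmod (v $ i))\<^sup>2)"
        by (metis complex_norm_square mult.commute)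
      then show "cnj (u i) * u i = complex_of_real ((cmod (v $ i))\<^sup>2) + (if i = 0 then 2 * complex_of_real t + 1 else 0)"
        using v0 by (simp add: u_def algebra_simps)
    qed
    also have "\<dots> = complex_of_real (\<Sum>i<n. (cmod (v $ i))\<^sup>2) + (2 * complex_of_real t + 1)"
      using n by (simp add: sum.distrib)
    also have "\<dots> = 2 * (1 + complex_of_real t)" unfolding unit by simp
    finally have s: "(\<Sum>i<n. cnj (u i) * u i) = 2 * (1 + complex_of_real t)" .
    have "(U\<^sup>\<dagger> * U) $$ (0, 0) = (\<Sum>i<n. cnj (u i) * u i)"
      using U by (subst index_mult_sum) (auto simp: U_def)
    then show ?thesis using U s by (intro eq_matI) (auto simp del: index_mult_mat(1))
  qed
  define H where "H = 1\<^sub>m n - c \<cdot>\<^sub>m (U * U\<^sup>\<dagger>)"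
  have H: "H \<in> carrier_mat n n" using U by (auto simp: H_def)
  have "H\<^sup>\<dagger> = H"
    using U c by (simp add: H_def adjoint_simps)
  moreover have "H * H = 1\<^sub>m n"
  proof -
    have "U * U\<^sup>\<dagger> * (U * U\<^sup>\<dagger>) = U * ((U\<^sup>\<dagger> * U) * U\<^sup>\<dagger>)"
      using U by (simp add: mat_ring_dim(1))
    also have "\<dots> = (2 * (1 + complex_of_real t)) \<cdot>\<^sub>m (U * U\<^sup>\<dagger>)"
      unfolding UU using U by (simp add: mat_ring_dim)
    finally have *: "U * U\<^sup>\<dagger> * (U * U\<^sup>\<dagger>) = (2 * (1 + complex_of_real t)) \<cdot>\<^sub>m (U * U\<^sup>\<dagger>)" .
    define M where "M = U * U\<^sup>\<dagger>"
    have M: "M \<in> carrier_mat n n" using U by (auto simp: M_def)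
    have cc: "c * (c * (2 * (1 + complex_of_real t))) = 2 * c"
      using c(2) by (metis mult.left_commute mult.right_neutral)
    show ?thesis
    proof (rule eq_matI)
      fix i j assume "i < dim_row (1\<^sub>m n)" "j < dim_col (1\<^sub>m n)"
      then have ij: "i < n" "j < n" by auto
      have "(H * H) $$ (i, j) = 1\<^sub>m n $$ (i, j) - 2 * c * M $$ (i, j) + c * (c * (M * M) $$ (i, j))"
        using ij M unfolding H_def M_def[symmetric]
        by (simp add: mat_ring_dim carrier_matD[OF M] right_diff_distrib del: index_mult_mat(1))
      also have "c * (c * (M * M) $$ (i, j)) = c * (c * (2 * (1 + complex_of_real t))) * M $$ (i, j)"
        using ij M *[folded M_def] by simp
      finally show "(H * H) $$ (i, j) = 1\<^sub>m n $$ (i, j)" unfolding cc by simp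
    qed (use H in auto)
  qed
  \<comment> \<open>Column 0 is e_0 - c (1 + t) u = e_0 - u = -v.\<close>
  moreover have "H $$ (i, 0) = - v $ i" if "i < n" for i
  proof -
    have "(U * U\<^sup>\<dagger>) $$ (i, 0) = u i * cnj (u 0)"
      using U n that by (subst index_mult_sum) (auto simp: U_def)
    moreover have "cnj (u 0) = 1 + complex_of_real t" using v0 by (simp add: u_def)
    ultimately have "H $$ (i, 0) = 1\<^sub>m n $$ (i, 0) - c * (1 + complex_of_real t) * u i"
      using U n that by (simp add: H_def del: index_mult_mat(1))
    then show ?thesis using n that unfolding c(2) by (simp add: u_def)
  qed
  ultimately show ?thesis using H by blast
qed

text \<open>An eigenvector may be multiplied by a phase; it is chosen to make coordinate 0 real and
  nonnegative, as \<open>householder\<close> demands.\<close>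

lemma unit_eigenvector:
  assumes A: "(A :: complex mat) \<in> carrier_mat n n" and n: "0 < n"
  obtains v k t where "v \<in> carrier_vec n" "A *\<^sub>v v = k \<cdot>\<^sub>v v" "(\<Sum>i<n. (cmod (v $ i))\<^sup>2) = 1"
    "v $ 0 = complex_of_real t" "0 \<le> t"
proof -
  obtain k where "k \<in> spectrum A" using spectrum_non_empty[OF A n] by blast
  then obtain w where w: "w \<in> carrier_vec n" "w \<noteq> 0\<^sub>v n" "A *\<^sub>v w = k \<cdot>\<^sub>v w"
    using A by (auto simp: spectrum_def eigenvalue_def eigenvector_def)
  define N where "N = (\<Sum>i<n. (cmod (w $ i))\<^sup>2)"
  obtain i where i: "i < n" "w $ i \<noteq> 0" using w by (metis carrier_vecD eq_vecI index_zero_vec)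
  have "0 < (cmod (w $ i))\<^sup>2" using i by simp
  also have "\<dots> \<le> N" unfolding N_def using i(1) by (intro member_le_sum) auto
  finally have N: "0 < N" .
  \<comment> \<open>When coordinate 0 vanishes any phase will do; 1 keeps \<open>ph\<close> of
    modulus one.\<close>
  define ph where "ph = (if w $ 0 = 0 then 1 else cnj (w $ 0) / complex_of_real (cmod (w $ 0)))"
  have ph: "cmod ph = 1" "ph * w $ 0 = complex_of_real (cmod (w $ 0))"
  proof -
    show "cmod ph = 1" by (simp add: ph_def norm_divide)
    show "ph * w $ 0 = complex_of_real (cmod (w $ 0))"
    proof (cases "w $ 0 = 0")
      case False
      have "cnj (w $ 0) * w $ 0 = complex_of_real (cmod (w $ 0)) * complex_of_real (cmod (w $ 0))"
        by (metis complex_norm_square mult.commute of_real_mult power2_eq_square)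
      then show ?thesis using False by (simp add: ph_def)
    qed simp
  qed
  define v where "v = (ph / complex_of_real (sqrt N)) \<cdot>\<^sub>v w"
  show thesis
  proof
    show "v \<in> carrier_vec n" using w by (simp add: v_def)
    show "A *\<^sub>v v = k \<cdot>\<^sub>v v"
      using A w by (simp add: v_def mult_mat_vec smult_smult_assoc mult.commute)
    have "(\<Sum>i<n. (cmod (v $ i))\<^sup>2) = (\<Sum>i<n. (cmod (w $ i))\<^sup>2 / N)"
      using w(1) N ph(1) by (intro sum.cong refl) (auto simp: v_def norm_mult norm_divide power_divide)
    also have "\<dots> = 1" using N by (simp add: N_def flip: sum_divide_distrib)
    finally show "(\<Sum>i<n. (cmod (v $ i))\<^sup>2) = 1" .
    have "v $ 0 = ph * w $ 0 / complex_of_real (sqrt N)" using w(1) n by (simp add: v_def)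
    then show "v $ 0 = complex_of_real (cmod (w $ 0) / sqrt N)" unfolding ph(2) by simp
    show "0 \<le> cmod (w $ 0) / sqrt N" using N by simp
  qed
qed

text \<open>Induction by deflation: conjugating with a reflection that sends e_0 to minus a unit
  eigenvector clears the first column below the diagonal. Normality clears the first row as well and
  passes to the remaining corner \<open>C\<close>.\<close>

theorem normal_diagonalization:
  fixes A :: "complex mat"
  assumes "A \<in> carrier_mat n n" "A\<^sup>\<dagger> * A = A * A\<^sup>\<dagger>"
  shows "\<exists>U\<in>carrier_mat n n. \<exists>d. U\<^sup>\<dagger> * U = 1\<^sub>m n \<and> A * U = U * diag_of n d"
  using assms
proof (induction n arbitrary: A)
  case 0
  then show ?case by (intro bexI[of _ "1\<^sub>m 0"]) (auto intro!: eq_matI)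
next
  case (Suc m)
  let ?n = "Suc m"
  note A = Suc.prems(1)
  obtain v k t where v: "v \<in> carrier_vec ?n" "A *\<^sub>v v = k \<cdot>\<^sub>v v" "(\<Sum>i<?n. (cmod (v $ i))\<^sup>2) = 1"
    "v $ 0 = complex_of_real t" "0 \<le> t"
    using unit_eigenvector[OF A] by blast
  obtain H where H: "H \<in> carrier_mat ?n ?n" "H\<^sup>\<dagger> = H" "H * H = 1\<^sub>m ?n"
    and Hcol: "\<And>i. i < ?n \<Longrightarrow> H $$ (i, 0) = - v $ i"
    using householder[OF _ v(1,3,4,5)] by auto
  define B where "B = H * A * H"
  have B: "B \<in> carrier_mat ?n ?n" using A H by (auto simp: B_def)
  note dims = carrier_matD[OF A] carrier_matD[OF H(1)] carrier_matD[OF B]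
  have HH: "H * (H * X) = X" if "dim_row X = ?n" for X
    using that dims H(3) by (metis mat_ring_dim(1,8))
  have Bn: "B\<^sup>\<dagger> * B = B * B\<^sup>\<dagger>"
  proof -
    have "B\<^sup>\<dagger> * B = H * (A\<^sup>\<dagger> * A) * H" and "B * B\<^sup>\<dagger> = H * (A * A\<^sup>\<dagger>) * H"
      using dims H(2) by (simp_all add: B_def adjoint_simps mat_ring_dim(1) HH)
    then show ?thesis using Suc.prems(2) by simp
  qed
  have Bcol: "B $$ (i, 0) = (if i = 0 then k else 0)" if i: "i < ?n" for i
  proof -
    have AH: "(A * H) $$ (l, 0) = k * H $$ (l, 0)" if l: "l < ?n" for l
    proof -
      have "(A * H) $$ (l, 0) = (\<Sum>j<?n. A $$ (l, j) * H $$ (j, 0))"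
        using dims l by (subst index_mult_sum) auto
      also have "\<dots> = (\<Sum>j<?n. - (A $$ (l, j) * v $ j))"
        using Hcol by (intro sum.cong refl) auto
      also have "\<dots> = - ((A *\<^sub>v v) $ l)"
        using dims l v(1) by (auto simp: scalar_prod_def sum_negf atLeast0LessThan simp del: sum.lessThan_Suc intro!: sum.cong)
      also have "\<dots> = k * H $$ (l, 0)" using l v(1) unfolding v(2) by (simp add: Hcol)
      finally show ?thesis .
    qed
    have "B $$ (i, 0) = (H * (A * H)) $$ (i, 0)" using dims by (simp add: B_def mat_ring_dim(1))
    also have "\<dots> = (\<Sum>l<?n. H $$ (i, l) * (A * H) $$ (l, 0))"
      using dims i by (subst index_mult_sum) auto
    also have "\<dots> = (\<Sum>l<?n. k * (H $$ (i, l) * H $$ (l, 0)))"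
      by (intro sum.cong refl) (simp add: AH del: index_mult_mat(1))
    also have "\<dots> = k * (H * H) $$ (i, 0)"
      using dims i by (subst index_mult_sum) (auto simp: sum_distrib_left simp del: sum.lessThan_Suc)
    finally show ?thesis using i unfolding H(3) by simp
  qed
  \<comment> \<open>The (0, 0) entries of the two products compare the norm of column 0 with that of
    row 0. The column consists of \<open>k\<close> alone and \<open>k\<close> also heads the row, so
    nothing is left for the other entries of the row.\<close>
  have Brow: "B $$ (0, j) = 0" if j: "0 < j" "j < ?n" for j
  proof -
    have "(B\<^sup>\<dagger> * B) $$ (0, 0) = complex_of_real (\<Sum>l<?n. (cmod (B $$ (l, 0)))\<^sup>2)"
      using B by (intro index_adjoint_mult_self) auto
    also have "(\<Sum>l<?n. (cmod (B $$ (l, 0)))\<^sup>2) = (\<Sum>l<?n. if l = 0 then (cmod k)\<^sup>2 else 0)"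
      by (intro sum.cong refl) (simp add: Bcol)
    finally have 1: "(B\<^sup>\<dagger> * B) $$ (0, 0) = complex_of_real ((cmod k)\<^sup>2)" by simp
    have "(B * B\<^sup>\<dagger>) $$ (0, 0) = complex_of_real (\<Sum>l<?n. (cmod (B\<^sup>\<dagger> $$ (l, 0)))\<^sup>2)"
      using index_adjoint_mult_self[of "B\<^sup>\<dagger>" ?n ?n 0] B by simp
    also have "(\<Sum>l<?n. (cmod (B\<^sup>\<dagger> $$ (l, 0)))\<^sup>2) = (\<Sum>l<?n. (cmod (B $$ (0, l)))\<^sup>2)"
      using dims by (intro sum.cong refl) auto
    also have "\<dots> = (cmod k)\<^sup>2 + (\<Sum>l<m. (cmod (B $$ (0, Suc l)))\<^sup>2)"
      using Bcol[of 0] by (simp add: sum.lessThan_Suc_shift del: sum.lessThan_Suc)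
    finally have "(\<Sum>l<m. (cmod (B $$ (0, Suc l)))\<^sup>2) = 0"
      using 1 Bn by (simp only: of_real_eq_iff)
    then have "\<forall>l<m. B $$ (0, Suc l) = 0" by (simp add: sum_nonneg_eq_0_iff)
    then show ?thesis using j by (metis Suc_less_eq gr0_implies_Suc)
  qed
  define C where "C = mat m m (\<lambda>(i, j). B $$ (Suc i, Suc j))"
  have C: "C \<in> carrier_mat m m" by (simp add: C_def)
  have BC: "B = four_block_mat (k \<cdot>\<^sub>m 1\<^sub>m 1) (0\<^sub>m 1 m) (0\<^sub>m m 1) C"
  proof (rule eq_matI)
    fix i j assume ij: "i < dim_row (four_block_mat (k \<cdot>\<^sub>m 1\<^sub>m 1) (0\<^sub>m 1 m) (0\<^sub>m m 1) C)"
      "j < dim_col (four_block_mat (k \<cdot>\<^sub>m 1\<^sub>m 1) (0\<^sub>m 1 m) (0\<^sub>m m 1) C)"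
    then have "i < ?n" "j < ?n" using C by auto
    then show "B $$ (i, j) = four_block_mat (k \<cdot>\<^sub>m 1\<^sub>m 1) (0\<^sub>m 1 m) (0\<^sub>m m 1) C $$ (i, j)"
      using Bcol[of i] Brow[of j] by (cases i; cases j) (auto simp: C_def)
  qed (use B C in auto)
  have "C\<^sup>\<dagger> * C = C * C\<^sup>\<dagger>"
  proof (rule eq_matI)
    fix i j assume "i < dim_row (C * C\<^sup>\<dagger>)" "j < dim_col (C * C\<^sup>\<dagger>)"
    then have ij: "i < m" "j < m" using C by auto
    have "(C\<^sup>\<dagger> * C) $$ (i, j) = (\<Sum>l<m. cnj (B $$ (Suc l, Suc i)) * B $$ (Suc l, Suc j))"
      using ij C by (subst index_mult_sum) (auto simp: C_def)
    also have "\<dots> = (\<Sum>l<?n. cnj (B $$ (l, Suc i)) * B $$ (l, Suc j))"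
      using Brow[of "Suc i"] ij by (simp add: sum.lessThan_Suc_shift del: sum.lessThan_Suc)
    also have "\<dots> = (B\<^sup>\<dagger> * B) $$ (Suc i, Suc j)"
      using ij dims by (subst index_mult_sum) auto
    also have "\<dots> = (\<Sum>l<?n. B $$ (Suc i, l) * cnj (B $$ (Suc j, l)))"
      unfolding Bn using ij dims by (subst index_mult_sum) auto
    also have "\<dots> = (\<Sum>l<m. B $$ (Suc i, Suc l) * cnj (B $$ (Suc j, Suc l)))"
      using Bcol[of "Suc i"] ij by (simp add: sum.lessThan_Suc_shift del: sum.lessThan_Suc)
    also have "\<dots> = (C * C\<^sup>\<dagger>) $$ (i, j)"
      using ij C by (subst index_mult_sum) (auto simp: C_def)
    finally show "(C\<^sup>\<dagger> * C) $$ (i, j) = (C * C\<^sup>\<dagger>) $$ (i, j)" .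
  qed (use C in auto)
  then obtain W d where W: "W \<in> carrier_mat m m" "W\<^sup>\<dagger> * W = 1\<^sub>m m" "C * W = W * diag_of m d"
    using Suc.IH[OF C] by blast
  define V where "V = four_block_mat (1\<^sub>m 1) (0\<^sub>m 1 m) (0\<^sub>m m 1) W"
  have V: "V \<in> carrier_mat ?n ?n" using four_block_carrier_mat[of "1\<^sub>m 1" 1 1 W m m] W by (simp add: V_def)
  have Vadj: "V\<^sup>\<dagger> = four_block_mat (1\<^sub>m 1) (0\<^sub>m 1 m) (0\<^sub>m m 1) (W\<^sup>\<dagger>)"
    unfolding V_def using W by (subst adjoint_four_block[of _ 1 1 _ m _ m]) auto
  have "V\<^sup>\<dagger> * V = four_block_mat (1\<^sub>m 1) (0\<^sub>m 1 m) (0\<^sub>m m 1) (1\<^sub>m m)"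
    unfolding Vadj unfolding V_def using W
    by (subst mult_four_block_mat[of _ 1 1 _ m _ m _ _ 1 _ m]) (auto simp: W(2))
  also have "\<dots> = 1\<^sub>m ?n" by (rule eq_matI) auto
  finally have VV: "V\<^sup>\<dagger> * V = 1\<^sub>m ?n" .
  define e where "e = case_nat k d"
  have D: "diag_of ?n e = four_block_mat (k \<cdot>\<^sub>m 1\<^sub>m 1) (0\<^sub>m 1 m) (0\<^sub>m m 1) (diag_of m d)"
    by (rule eq_matI) (auto simp: e_def split: nat.splits)
  have "B * V = V * diag_of ?n e"
    unfolding D V_def BC using W C
    by (simp add: mult_four_block_mat[of _ 1 1 _ m _ m _ _ 1 _ m])
  then have "A * (H * V) = H * V * diag_of ?n e"
    using dims V HH[of "A * (H * V)"] by (simp add: B_def mat_ring_dim(1))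
  moreover have "(H * V)\<^sup>\<dagger> * (H * V) = 1\<^sub>m ?n"
    using dims V VV H(2) HH[of V] by (simp add: adjoint_simps mat_ring_dim(1))
  moreover have "H * V \<in> carrier_mat ?n ?n" using H V by auto
  ultimately show ?case by blast
qed

subsection \<open>Matrix convexity\<close>

lemma mat_sum_swap:
  "mat_sum s (\<lambda>i. mat_sum s (\<lambda>j. A i j) J) I = mat_sum s (\<lambda>j. mat_sum s (\<lambda>i. A i j) I) J"
  by (rule eq_matI) (auto intro: sum.swap)

text \<open>After exchanging the sums over outcomes and over \<open>j\<close>, the effects of each
  \<open>Y j\<close> add up to the identity and only the Gram matrices of the \<open>V j\<close>
  remain.\<close>

lemma povm_compression:
  assumes len: "length X = n"
    and Y: "\<And>j. j < m \<Longrightarrow> povm n d (Y j)" and V: "\<And>j. j < m \<Longrightarrow> V j \<in> carrier_mat d s"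
    and one: "mat_sum s (\<lambda>j. (V j)\<^sup>\<dagger> * V j) {..<m::nat} = 1\<^sub>m s"
    and X: "\<And>i. i < n \<Longrightarrow> X ! i = mat_sum s (\<lambda>j. (V j)\<^sup>\<dagger> * (Y j ! i) * V j) {..<m}"
  shows "povm n s X"
proof -
  have "psd s (X ! i)" if "i < n" for i
    unfolding X[OF that] by (intro psd_mat_sum psd_congruence[of d]) (auto intro: povm_nth[OF Y] V that)
  moreover have "mat_sum s (\<lambda>i. X ! i) {..<n} = 1\<^sub>m s"
  proof -
    have "mat_sum s (\<lambda>i. X ! i) {..<n} =
        mat_sum s (\<lambda>i. mat_sum s (\<lambda>j. (V j)\<^sup>\<dagger> * (Y j ! i) * V j) {..<m}) {..<n}"
      by (intro mat_sum_cong) (simp add: X)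
    also have "\<dots> = mat_sum s (\<lambda>j. mat_sum s (\<lambda>i. (V j)\<^sup>\<dagger> * (Y j ! i) * V j) {..<n}) {..<m}"
      by (rule mat_sum_swap)
    also have "\<dots> = mat_sum s (\<lambda>j. (V j)\<^sup>\<dagger> * V j) {..<m}"
    proof (rule mat_sum_cong)
      fix j assume "j \<in> {..<m}"
      then have j: "j < m" by simp
      have "mat_sum s (\<lambda>i. (V j)\<^sup>\<dagger> * (Y j ! i) * V j) {..<n} = (V j)\<^sup>\<dagger> * mat_sum d (\<lambda>i. Y j ! i) {..<n} * V j"
        by (rule mat_sum_mult[symmetric]) (use V[OF j] psd_carrier[OF povm_nth[OF Y[OF j]]] in auto)
      then show "mat_sum s (\<lambda>i. (V j)\<^sup>\<dagger> * (Y j ! i) * V j) {..<n} = (V j)\<^sup>\<dagger> * V j"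
        using V[OF j] unfolding povm_sum[OF Y[OF j]] by (simp add: mat_ring_dim)
    qed
    finally show ?thesis using one by simp
  qed
  ultimately show ?thesis using len by (simp add: povm_def)
qed

lemma mconv_B_ph_subset: "mconv (p + q) d (B_ph p q d) s \<subseteq> B_ph p q s"
proof
  fix X assume "X \<in> mconv (p + q) d (B_ph p q d) s"
  then obtain m Y V where len: "length X = p + q" and Y: "\<And>j. j < m \<Longrightarrow> Y j \<in> B_ph p q d"
    and V: "\<And>j. j < m \<Longrightarrow> V j \<in> carrier_mat d s"
    and one: "mat_sum s (\<lambda>j. (V j)\<^sup>\<dagger> * V j) {..<m::nat} = 1\<^sub>m s"
    and X: "\<And>i. i < p + q \<Longrightarrow> X ! i = mat_sum s (\<lambda>j. (V j)\<^sup>\<dagger> * (Y j ! i) * V j) {..<m}"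
    unfolding mconv_def by auto
  have Y': "povm p d (take p (Y j)) \<and> povm q d (drop p (Y j)) \<and> length (Y j) = p + q" if "j < m" for j
    using Y[OF that] by (auto simp: B_ph_def povm_length)
  have "povm p s (take p X)"
    by (rule povm_compression[where Y = "\<lambda>j. take p (Y j)", OF _ _ V one]) (use len X Y' in auto)
  moreover have "povm q s (drop p X)"
  proof (rule povm_compression[where Y = "\<lambda>j. drop p (Y j)", OF _ _ V one])
    fix i assume "i < q"
    then show "drop p X ! i = mat_sum s (\<lambda>j. (V j)\<^sup>\<dagger> * (drop p (Y j) ! i) * V j) {..<m}"
      using len Y' X[of "p + i"] by (auto intro!: mat_sum_cong)
  qed (use len Y' in auto)
  ultimately show "X \<in> B_ph p q s"
    unfolding B_ph_def by (metis (mono_tags, lifting) append_take_drop_id mem_Collect_eq)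
qed

text \<open>A dichotomic measurement is a single effect, which reduces the case p = q = 2 to pairs
  of effects.\<close>

lemma povm_2: "povm 2 s E \<longleftrightarrow> (\<exists>e. E = [e, 1\<^sub>m s - e] \<and> psd s e \<and> psd s (1\<^sub>m s - e))"
proof
  assume E: "povm 2 s E"
  then obtain e f where ef: "E = [e, f]"
    by (auto simp: povm_def length_Suc_conv numeral_2_eq_2)
  have p: "psd s e" "psd s f" using povm_nth[OF E, of 0] povm_nth[OF E, of 1] by (auto simp: ef)
  have c: "e \<in> carrier_mat s s" "f \<in> carrier_mat s s" using p by (auto simp: psd_iff)
  have "f = mat_sum s (\<lambda>i. E ! i) {..<2} - e"
    using c by (intro eq_matI) (auto simp: ef numeral_2_eq_2)
  then show "\<exists>e. E = [e, 1\<^sub>m s - e] \<and> psd s e \<and> psd s (1\<^sub>m s - e)"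
    unfolding povm_sum[OF E] using ef p by auto
next
  assume "\<exists>e. E = [e, 1\<^sub>m s - e] \<and> psd s e \<and> psd s (1\<^sub>m s - e)"
  then obtain e where e: "E = [e, 1\<^sub>m s - e]" "psd s e" "psd s (1\<^sub>m s - e)" by blast
  have "mat_sum s (\<lambda>i. E ! i) {..<2} = 1\<^sub>m s"
    using psd_carrier[OF e(2)] by (intro eq_matI) (auto simp: e(1) numeral_2_eq_2)
  then show "povm 2 s E" using e by (auto simp: povm_def less_2_cases_iff)
qed

subsection \<open>Two dichotomic measurements\<close>

lemma psd_diag_entry:
  assumes A: "psd s A" and i: "i < s"
  shows "\<exists>r\<ge>0. A $$ (i, i) = complex_of_real r"
proof -
  have c: "A \<in> carrier_mat s s" "A\<^sup>\<dagger> = A" using A by (auto simp: psd_iff)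
  have "A\<^sup>\<dagger> $$ (i, i) = cnj (A $$ (i, i))" using c(1) i by simp
  then have "A $$ (i, i) = complex_of_real (Re (A $$ (i, i)))"
    unfolding c(2) by (metis Reals_cnj_iff of_real_Re)
  moreover have "0 \<le> Re (A $$ (i, i))"
    using A i quad_unit_vec[OF c(1) i] by (metis psd_iff unit_vec_carrier)
  ultimately show ?thesis by blast
qed

text \<open>The root of E - E^2 is built in an eigenbasis of \<open>E\<close> by applying r -> sqrt
  (r (1 - r)) to the eigenvalues. As a function of \<open>E\<close> it commutes with
  \<open>E\<close>, which the idempotence in \<open>halmos_dilation\<close> relies on.\<close>

lemma exists_defect_root:
  assumes E: "psd s E" "psd s (1\<^sub>m s - E)"
  obtains S where "S \<in> carrier_mat s s" "S\<^sup>\<dagger> = S" "S * S = E - E * E" "S * E = E * S"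
proof -
  have c: "E \<in> carrier_mat s s" "E\<^sup>\<dagger> = E" using E by (auto simp: psd_iff)
  obtain U d where U: "U \<in> carrier_mat s s" "U\<^sup>\<dagger> * U = 1\<^sub>m s" "E * U = U * diag_of s d"
    using normal_diagonalization[OF c(1)] c(2) by auto
  have UU: "U * U\<^sup>\<dagger> = 1\<^sub>m s"
    using mat_mult_left_right_inverse[OF adjoint_carrier[OF U(1)] U(1) U(2)] .
  note dims = carrier_matD[OF c(1)] carrier_matD[OF U(1)]
  have cancel: "U\<^sup>\<dagger> * (U * X) = X" "U * (U\<^sup>\<dagger> * X) = X" if "dim_row X = s" for X
    using that dims U(2) UU by (metis dim_adjoint mat_ring_dim(1,8))+
  have D: "U\<^sup>\<dagger> * E * U = diag_of s d"
    using dims U(3) by (simp add: mat_ring_dim(1) cancel)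
  have D': "U\<^sup>\<dagger> * (1\<^sub>m s - E) * U = 1\<^sub>m s - diag_of s d"
    using dims U(2,3) by (simp add: mat_ring_dim cancel)
  have EU: "E = U * diag_of s d * U\<^sup>\<dagger>"
    using dims UU by (simp add: U(3)[symmetric] mat_ring_dim)
  \<comment> \<open>The eigenvalues are diagonal entries of a congruence of \<open>E\<close>, and
    their complements to 1 are those of a congruence of 1 - E. Both are nonnegative, so the radicand
    is nonnegative.\<close>
  have "\<exists>r. 0 \<le> r \<and> r \<le> 1 \<and> d i = complex_of_real r" if i: "i < s" for i
  proof -
    obtain r where r: "0 \<le> r" "d i = complex_of_real r"
      using psd_diag_entry[OF psd_congruence[OF E(1) U(1)] i] i unfolding D by auto
    obtain r' where r': "0 \<le> r'" "1 - d i = complex_of_real r'"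
      using psd_diag_entry[OF psd_congruence[OF E(2) U(1)] i] i unfolding D' by auto
    have "r' = 1 - r" using r r' by (metis of_real_1 of_real_diff of_real_eq_iff)
    then show ?thesis using r r' by auto
  qed
  then obtain r where r: "\<And>i. i < s \<Longrightarrow> 0 \<le> r i \<and> r i \<le> 1 \<and> d i = complex_of_real (r i)"
    by metis
  define g where "g i = complex_of_real (sqrt (r i * (1 - r i)))" for i
  have cnj_g: "(\<lambda>i. cnj (g i)) = g" by (simp add: g_def[abs_def])
  define S where "S = U * diag_of s g * U\<^sup>\<dagger>"
  have prod: "U * diag_of s a * U\<^sup>\<dagger> * (U * diag_of s b * U\<^sup>\<dagger>) = U * diag_of s (\<lambda>i. a i * b i) * U\<^sup>\<dagger>" for a b
    using dims by (simp add: mat_ring_dim(1) cancel flip: mult_diag_of)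
  have diag_eq: "diag_of s a = diag_of s b" if "\<And>i. i < s \<Longrightarrow> a i = b i" for a b
    using that by (intro eq_matI) auto
  show thesis
  proof
    show "S \<in> carrier_mat s s" using U by (auto simp: S_def)
    show "S\<^sup>\<dagger> = S"
      using dims by (simp add: S_def adjoint_simps adjoint_diag_of mat_ring_dim(1) cnj_g)
    have "S * S = U * diag_of s (\<lambda>i. g i * g i) * U\<^sup>\<dagger>" unfolding S_def by (rule prod)
    also have "diag_of s (\<lambda>i. g i * g i) = diag_of s (\<lambda>i. d i - d i * d i)"
    proof (rule diag_eq)
      fix i assume "i < s"
      then have "g i * g i = complex_of_real (r i * (1 - r i))"
        using r[of i] unfolding g_def by (simp flip: of_real_mult)
      then show "g i * g i = d i - d i * d i" using r[OF \<open>i < s\<close>] by (simp add: algebra_simps)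
    qed
    also have "\<dots> = diag_of s d - diag_of s (\<lambda>i. d i * d i)" by (rule eq_matI) auto
    also have "U * (diag_of s d - diag_of s (\<lambda>i. d i * d i)) * U\<^sup>\<dagger> = E - E * E"
      using dims by (subst (1 2 3) EU) (simp add: prod, simp add: mat_ring_dim)
    finally show "S * S = E - E * E" .
    have "S * E = U * diag_of s (\<lambda>i. g i * d i) * U\<^sup>\<dagger>" unfolding S_def by (subst EU) (rule prod)
    also have "\<dots> = U * diag_of s (\<lambda>i. d i * g i) * U\<^sup>\<dagger>" by (simp add: mult.commute)
    also have "\<dots> = E * S" unfolding S_def by (subst EU) (rule prod[symmetric])
    finally show "S * E = E * S" .
  qed
qed

text \<open>With S the root of E - E^2, the block matrix with rows (E, S) and (S, 1 - E) is
  idempotent because S^2 = E - E^2 and S commutes with E.\<close>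

lemma halmos_dilation:
  assumes E: "psd s E" "psd s (1\<^sub>m s - E)"
  obtains P where "projection (s + s) P" "(incl_mat s s)\<^sup>\<dagger> * P * incl_mat s s = E"
proof -
  have c: "E \<in> carrier_mat s s" "E\<^sup>\<dagger> = E" using E by (auto simp: psd_iff)
  obtain S where S: "S \<in> carrier_mat s s" "S\<^sup>\<dagger> = S" "S * S = E - E * E" "S * E = E * S"
    using exists_defect_root[OF E] .
  note dims = carrier_matD[OF c(1)] carrier_matD[OF S(1)]
  define P where "P = four_block_mat E S S (1\<^sub>m s - E)"
  have P: "P \<in> carrier_mat (s + s) (s + s)" using c by (auto simp: P_def)
  have Padj: "P\<^sup>\<dagger> = P"
    unfolding P_def using c S by (subst adjoint_four_block[of _ s s _ s _ s]) (auto simp: adjoint_minus)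
  have "E * E + S * S = E" "E * S + S * (1\<^sub>m s - E) = S" "S * E + (1\<^sub>m s - E) * S = S"
    "S * S + (1\<^sub>m s - E) * (1\<^sub>m s - E) = 1\<^sub>m s - E"
    using dims S(3,4) by (auto simp: mat_ring_dim simp del: index_mult_mat(1) intro!: eq_matI)
  then have "P * P = P"
    unfolding P_def using c S by (subst mult_four_block_mat[of _ s s _ s _ s _ _ s _ s]) auto
  then have "projection (s + s) P" using P Padj by (simp add: projection_def Her_def)
  moreover have "(incl_mat s s)\<^sup>\<dagger> * P * incl_mat s s = E"
    unfolding P_def using c S by (intro compress_four_block) auto
  ultimately show thesis by (rule that)
qed

text \<open>With the reflections \<open>u = 2 P - I\<close> and \<open>v = 2 Q - I\<close>, each eigenvector \<open>w\<close> of the unitary \<open>u v\<close>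
  spans together with \<open>v w\<close> a subspace invariant under \<open>u\<close> and \<open>v\<close>; over an orthonormal eigenbasis
  the matrices with columns \<open>w\<close>, \<open>v w\<close> form a resolution of twice the identity.\<close>

lemma projection_pair_decomposition:
  assumes P: "projection n P" and Q: "projection n Q"
  obtains V A B where "\<And>a. a < n \<Longrightarrow> V a \<in> carrier_mat 2 n" "\<And>a. a < n \<Longrightarrow> projection 2 (A a)"
    "\<And>a. a < n \<Longrightarrow> projection 2 (B a)" "mat_sum n (\<lambda>a. (V a)\<^sup>\<dagger> * V a) {..<n} = 1\<^sub>m n"
    "\<And>a. a < n \<Longrightarrow> P * (V a)\<^sup>\<dagger> = (V a)\<^sup>\<dagger> * A a" "\<And>a. a < n \<Longrightarrow> Q * (V a)\<^sup>\<dagger> = (V a)\<^sup>\<dagger> * B a"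
proof -
  have Pc: "P \<in> carrier_mat n n" "P\<^sup>\<dagger> = P" "P * P = P" and Qc: "Q \<in> carrier_mat n n" "Q\<^sup>\<dagger> = Q" "Q * Q = Q"
    using P Q by (auto simp: projection_def Her_def)
  note dPQ = carrier_matD[OF Pc(1)] carrier_matD[OF Qc(1)]
  define u where "u = 2 \<cdot>\<^sub>m P - 1\<^sub>m n"
  define v where "v = 2 \<cdot>\<^sub>m Q - 1\<^sub>m n"
  have u: "u \<in> carrier_mat n n" "u\<^sup>\<dagger> = u" and v: "v \<in> carrier_mat n n" "v\<^sup>\<dagger> = v"
    using Pc Qc by (auto simp: u_def v_def adjoint_simps)
  have uu: "u * u = 1\<^sub>m n" and vv: "v * v = 1\<^sub>m n"
    using dPQ Pc(3) Qc(3) unfolding u_def v_def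
    by (auto simp: mat_ring_dim algebra_simps simp del: index_mult_mat(1) intro!: eq_matI)
  note duv = carrier_matD[OF u(1)] carrier_matD[OF v(1)]
  have uuX: "u * (u * X) = X" and vvX: "v * (v * X) = X" if "dim_row X = n" for X
    using that duv uu vv by (metis mat_ring_dim(1,8))+
  have adj: "(u * v)\<^sup>\<dagger> = v * u" using duv u v by (simp add: adjoint_mult)
  \<comment> \<open>A product of two Hermitian involutions is unitary, hence normal and
    diagonalizable although rarely Hermitian.\<close>
  have unit: "(u * v)\<^sup>\<dagger> * (u * v) = 1\<^sub>m n" "(u * v) * (u * v)\<^sup>\<dagger> = 1\<^sub>m n"
    unfolding adj using duv uu vv by (simp_all add: mat_ring_dim(1) uuX vvX)
  obtain W d where W: "W \<in> carrier_mat n n" "W\<^sup>\<dagger> * W = 1\<^sub>m n" "u * v * W = W * diag_of n d"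
    using normal_diagonalization[of "u * v" n] unit u v by auto
  have WW: "W * W\<^sup>\<dagger> = 1\<^sub>m n"
    using mat_mult_left_right_inverse[OF adjoint_carrier[OF W(1)] W(1) W(2)] .
  note dims = duv carrier_matD[OF W(1)]
  have WX: "W\<^sup>\<dagger> * (W * X) = X" "W * (W\<^sup>\<dagger> * X) = X" if "dim_row X = n" for X
    using that dims W(2) WW by (metis dim_adjoint mat_ring_dim(1,8))+
  let ?D = "diag_of n d"
  have D: "?D = W\<^sup>\<dagger> * (u * (v * W))"
    using dims W(3) by (simp add: mat_ring_dim(1) WX)
  have Dadj: "?D\<^sup>\<dagger> = W\<^sup>\<dagger> * (v * (u * W))"
    unfolding D using dims u v by (simp add: adjoint_simps mat_ring_dim(1))
  have "?D\<^sup>\<dagger> * ?D = 1\<^sub>m n"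
    unfolding Dadj unfolding D using dims W(2) by (simp add: mat_ring_dim(1) WX uuX vvX)
  then have "diag_of n (\<lambda>a. cnj (d a) * d a) = 1\<^sub>m n" unfolding adjoint_diag_of mult_diag_of .
  then have dd: "cnj (d a) * d a = 1" if "a < n" for a
    using that index_diag_of[of a n a "\<lambda>a. cnj (d a) * d a"] by simp
  define Z where "Z = v * W"
  have Z: "Z \<in> carrier_mat n n" using v W by (auto simp: Z_def)
  \<comment> \<open>For an eigenvector w with eigenvalue d and z = v w, the reflection v swaps w and
    z, while u z = d w and, as |d| = 1, u w = cnj d z. These are the columnwise forms of the
    identities for \<open>W\<close> and \<open>Z\<close>.\<close>
  have vW: "v * W = Z" and vZ: "v * Z = W" and uZ: "u * Z = W * ?D"
    using dims W(3) by (simp_all add: Z_def vvX mat_ring_dim(1))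
  have uW: "u * W = Z * ?D\<^sup>\<dagger>"
    unfolding Dadj using dims by (simp add: Z_def mat_ring_dim(1) WX vvX)
  define T where "T a = mat n 2 (\<lambda>(i, j). if j = 0 then W $$ (i, a) else Z $$ (i, a))" for a
  have T: "T a \<in> carrier_mat n 2" and dT: "dim_row (T a) = n" "dim_col (T a) = 2" for a by (auto simp: T_def)
  have XT: "(X * T a) $$ (i, j) = (if j = 0 then (X * W) $$ (i, a) else (X * Z) $$ (i, a))"
    if "X \<in> carrier_mat n n" "i < n" "j < 2" "a < n" for X i j a
    using that T[of a] W(1) Z by (auto simp: index_mult_sum T_def simp del: index_mult_mat(1))
  have TM: "(T a * M) $$ (i, j) = W $$ (i, a) * M $$ (0, j) + Z $$ (i, a) * M $$ (1, j)"
    if "M \<in> carrier_mat 2 2" "i < n" "j < 2" for M i j a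
    using that T[of a] by (auto simp: index_mult_sum T_def numeral_2_eq_2 simp del: index_mult_mat(1))
  \<comment> \<open>\<open>A a\<close> and \<open>B a\<close> are (1 + M) / 2, with M the matrix by
    which u, respectively v, acts on the pair (w, v w). They are projections because |d| = 1,
    whether or not the two vectors are independent.\<close>
  define A where "A a = mat 2 2 (\<lambda>(i, j). if i = j then 1 / 2 else if i = 0 then d a / 2 else cnj (d a) / 2)" for a
  define B where "B a = (mat 2 2 (\<lambda>_. 1 / 2) :: complex mat)" for a :: nat
  have A: "A a \<in> carrier_mat 2 2" and B: "B a \<in> carrier_mat 2 2" for a by (auto simp: A_def B_def)
  have PT: "P * T a = T a * A a" if a: "a < n" for a
  proof (rule eq_matI)
    fix i j assume "i < dim_row (T a * A a)" "j < dim_col (T a * A a)"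
    then have ij: "i < n" "j < 2" using dT A by (auto simp: A_def)
    have "(u * T a) $$ (i, j) = 2 * (P * T a) $$ (i, j) - T a $$ (i, j)"
      unfolding u_def using ij dPQ dT by (simp add: mat_ring_dim del: index_mult_mat(1))
    moreover have "(u * T a) $$ (i, j) = (if j = 0 then Z $$ (i, a) * cnj (d a) else W $$ (i, a) * d a)"
      unfolding XT[OF u(1) ij a] uW uZ adjoint_diag_of using W(1) Z ij a
      by (simp add: index_mult_diag_of[of _ n] del: index_mult_mat(1))
    ultimately have "2 * (P * T a) $$ (i, j) = T a $$ (i, j) + (if j = 0 then Z $$ (i, a) * cnj (d a) else W $$ (i, a) * d a)"
      by simp
    moreover have "2 * (T a * A a) $$ (i, j) = T a $$ (i, j) + (if j = 0 then Z $$ (i, a) * cnj (d a) else W $$ (i, a) * d a)"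
      unfolding TM[OF A ij] using ij by (auto simp: A_def T_def less_2_cases_iff)
    ultimately show "(P * T a) $$ (i, j) = (T a * A a) $$ (i, j)"
      by (metis mult_cancel_left zero_neq_numeral)
  qed (use dPQ dT carrier_matD[OF A] in auto)
  have QT: "Q * T a = T a * B a" if a: "a < n" for a
  proof (rule eq_matI)
    fix i j assume "i < dim_row (T a * B a)" "j < dim_col (T a * B a)"
    then have ij: "i < n" "j < 2" using dT B by (auto simp: B_def)
    have "(v * T a) $$ (i, j) = 2 * (Q * T a) $$ (i, j) - T a $$ (i, j)"
      unfolding v_def using ij dPQ dT by (simp add: mat_ring_dim del: index_mult_mat(1))
    moreover have "(v * T a) $$ (i, j) = (if j = 0 then Z $$ (i, a) else W $$ (i, a))"
      unfolding XT[OF v(1) ij a] vW vZ ..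
    ultimately have "2 * (Q * T a) $$ (i, j) = T a $$ (i, j) + (if j = 0 then Z $$ (i, a) else W $$ (i, a))"
      by simp
    moreover have "2 * (T a * B a) $$ (i, j) = T a $$ (i, j) + (if j = 0 then Z $$ (i, a) else W $$ (i, a))"
      unfolding TM[OF B ij] using ij by (auto simp: B_def T_def less_2_cases_iff)
    ultimately show "(Q * T a) $$ (i, j) = (T a * B a) $$ (i, j)"
      by (metis mult_cancel_left zero_neq_numeral)
  qed (use dPQ dT carrier_matD[OF B] in auto)
  have projA: "projection 2 (A a)" if "a < n" for a
  proof -
    have "A a * A a = A a"
      using A[of a] dd[OF that] by (intro eq_matI)
        (auto simp: index_mult_sum A_def numeral_2_eq_2 less_Suc_eq field_simps simp del: index_mult_mat(1))
    moreover have "(A a)\<^sup>\<dagger> = A a" by (rule eq_matI) (auto simp: A_def less_2_cases_iff)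
    ultimately show ?thesis using A by (simp add: projection_def Her_def)
  qed
  have projB: "projection 2 (B a)" for a
  proof -
    have "B a * B a = B a"
      by (intro eq_matI) (auto simp: index_mult_sum B_def numeral_2_eq_2 simp del: index_mult_mat(1))
    moreover have "(B a)\<^sup>\<dagger> = B a" by (rule eq_matI) (auto simp: B_def)
    ultimately show ?thesis using B by (simp add: projection_def Her_def)
  qed
  \<comment> \<open>Both \<open>W\<close> and \<open>Z = v * W\<close> are unitary, so the matrices
    T_a T_a^* sum to twice the identity; the factor 1 / sqrt 2 in each \<open>V a\<close> normalizes
    this.\<close>
  define c where "c = complex_of_real (1 / sqrt 2)"
  have c: "cnj c = c" "c * c = 1 / 2"
  proof -
    show "cnj c = c" by (simp add: c_def)
    have "c * c = complex_of_real (1 / sqrt 2 * (1 / sqrt 2))" unfolding c_def of_real_mult ..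
    then show "c * c = 1 / 2" by simp
  qed
  define V where "V a = c \<cdot>\<^sub>m (T a)\<^sup>\<dagger>" for a
  have V: "V a \<in> carrier_mat 2 n" and Vadj: "(V a)\<^sup>\<dagger> = c \<cdot>\<^sub>m T a" for a
    using T[of a] by (auto simp: V_def adjoint_smult c)
  have "mat_sum n (\<lambda>a. (V a)\<^sup>\<dagger> * V a) {..<n} = 1\<^sub>m n"
  proof (rule eq_matI)
    fix i j assume "i < dim_row (1\<^sub>m n)" "j < dim_col (1\<^sub>m n)"
    then have ij: "i < n" "j < n" by auto
    have VV: "((V a)\<^sup>\<dagger> * V a) $$ (i, j) = (W $$ (i, a) * cnj (W $$ (j, a)) + Z $$ (i, a) * cnj (Z $$ (j, a))) / 2"
      if "a < n" for a
    proof -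
      have "((V a)\<^sup>\<dagger> * V a) $$ (i, j) = c * c * (T a * (T a)\<^sup>\<dagger>) $$ (i, j)"
        unfolding Vadj unfolding V_def using dT[of a] ij by (simp add: mat_ring_dim del: index_mult_mat(1))
      also have "(T a * (T a)\<^sup>\<dagger>) $$ (i, j) = W $$ (i, a) * cnj (W $$ (j, a)) + Z $$ (i, a) * cnj (Z $$ (j, a))"
        using ij T[of a] by (subst index_mult_sum) (auto simp: T_def numeral_2_eq_2)
      finally show ?thesis unfolding c(2) by simp
    qed
    have "mat_sum n (\<lambda>a. (V a)\<^sup>\<dagger> * V a) {..<n} $$ (i, j) =
        ((\<Sum>a<n. W $$ (i, a) * cnj (W $$ (j, a))) + (\<Sum>a<n. Z $$ (i, a) * cnj (Z $$ (j, a)))) / 2"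
      using ij by (simp add: VV sum.distrib add_divide_distrib sum_divide_distrib del: index_mult_mat(1))
    also have "(\<Sum>a<n. W $$ (i, a) * cnj (W $$ (j, a))) = (W * W\<^sup>\<dagger>) $$ (i, j)"
      using ij W(1) by (subst index_mult_sum) auto
    also have "(\<Sum>a<n. Z $$ (i, a) * cnj (Z $$ (j, a))) = (Z * Z\<^sup>\<dagger>) $$ (i, j)"
      using ij Z by (subst index_mult_sum) auto
    also have "Z * Z\<^sup>\<dagger> = 1\<^sub>m n"
      unfolding Z_def using dims v vv by (simp add: adjoint_simps mat_ring_dim(1) WX)
    finally show "mat_sum n (\<lambda>a. (V a)\<^sup>\<dagger> * V a) {..<n} $$ (i, j) = 1\<^sub>m n $$ (i, j)"
      unfolding WW by simp
  qed auto
  moreover have "P * (V a)\<^sup>\<dagger> = (V a)\<^sup>\<dagger> * A a" "Q * (V a)\<^sup>\<dagger> = (V a)\<^sup>\<dagger> * B a" if "a < n" for a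
    unfolding Vadj using PT[OF that] QT[OF that] dPQ dT[of a] A[of a] B[of a] by (simp_all add: mat_ring_dim carrier_matD[OF A] carrier_matD[OF B])
  ultimately show thesis using V projA projB by (intro that[of V A B])
qed

text \<open>The dilation by the inclusion J and the resolution by the V_a compose: e = J^* P J
  becomes the sum of R_a^* A_a R_a with R_a = V_a J, and likewise for f with the same R_a.\<close>

lemma B_ph_2_2_subset_mconv: "B_ph 2 2 s \<subseteq> mconv (2 + 2) 2 (B_ph 2 2 2) s"
proof
  fix X assume "X \<in> B_ph 2 2 s"
  then obtain e f where X: "X = [e, 1\<^sub>m s - e, f, 1\<^sub>m s - f]"
    and e: "psd s e" "psd s (1\<^sub>m s - e)" and f: "psd s f" "psd s (1\<^sub>m s - f)"
    by (auto simp: B_ph_def povm_2)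
  define n where "n = s + s"
  define J where "J = incl_mat s s"
  have J: "J \<in> carrier_mat n s" "J\<^sup>\<dagger> * J = 1\<^sub>m s" by (simp_all add: J_def n_def incl_isometry)
  obtain P where P: "projection n P" "J\<^sup>\<dagger> * P * J = e"
    using halmos_dilation[OF e] unfolding n_def J_def .
  obtain Q where Q: "projection n Q" "J\<^sup>\<dagger> * Q * J = f"
    using halmos_dilation[OF f] unfolding n_def J_def .
  have Pc: "P \<in> carrier_mat n n" and Qc: "Q \<in> carrier_mat n n"
    using P Q by (auto simp: projection_def Her_def)
  obtain V A B where V: "\<And>a. a < n \<Longrightarrow> V a \<in> carrier_mat 2 n" and A: "\<And>a. a < n \<Longrightarrow> projection 2 (A a)"
    and B: "\<And>a. a < n \<Longrightarrow> projection 2 (B a)" and one: "mat_sum n (\<lambda>a. (V a)\<^sup>\<dagger> * V a) {..<n} = 1\<^sub>m n"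
    and PV: "\<And>a. a < n \<Longrightarrow> P * (V a)\<^sup>\<dagger> = (V a)\<^sup>\<dagger> * A a" and QV: "\<And>a. a < n \<Longrightarrow> Q * (V a)\<^sup>\<dagger> = (V a)\<^sup>\<dagger> * B a"
    using projection_pair_decomposition[OF P(1) Q(1)] by blast
  have Ac: "A a \<in> carrier_mat 2 2" and Bc: "B a \<in> carrier_mat 2 2" if "a < n" for a
    using A[OF that] B[OF that] by (auto simp: projection_def Her_def)
  define Y where "Y a = [A a, 1\<^sub>m 2 - A a, B a, 1\<^sub>m 2 - B a]" for a
  define R where "R a = V a * J" for a
  have R: "R a \<in> carrier_mat 2 s" if "a < n" for a using V[OF that] J by (auto simp: R_def)
  have Y: "Y a \<in> B_ph 2 2 2" if "a < n" for a
  proof -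
    have "povm 2 2 [A a, 1\<^sub>m 2 - A a]" "povm 2 2 [B a, 1\<^sub>m 2 - B a]"
      using A[OF that] B[OF that] by (auto simp: povm_2 projection_psd projection_complement)
    then show ?thesis unfolding B_ph_def Y_def
      by (intro CollectI exI[of _ "[A a, 1\<^sub>m 2 - A a]"] exI[of _ "[B a, 1\<^sub>m 2 - B a]"]) simp
  qed
  \<comment> \<open>The resolution of the identity is inserted between \<open>Z\<close> and
    \<open>J\<close>. The statement is general in \<open>Z\<close> and \<open>G\<close> so that it
    serves \<open>P\<close> and \<open>Q\<close>, their complements, and the identity, the last
    giving the normalization \<open>RR\<close>.\<close>
  have key: "mat_sum s (\<lambda>a. (R a)\<^sup>\<dagger> * G a * R a) {..<n} = J\<^sup>\<dagger> * Z * J"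
    if Z: "Z \<in> carrier_mat n n" and G: "\<And>a. a < n \<Longrightarrow> G a \<in> carrier_mat 2 2"
      and ZV: "\<And>a. a < n \<Longrightarrow> Z * (V a)\<^sup>\<dagger> = (V a)\<^sup>\<dagger> * G a" for Z G
  proof -
    have "mat_sum s (\<lambda>a. (R a)\<^sup>\<dagger> * G a * R a) {..<n} = mat_sum s (\<lambda>a. J\<^sup>\<dagger> * Z * ((V a)\<^sup>\<dagger> * V a) * J) {..<n}"
    proof (rule mat_sum_cong)
      fix a assume "a \<in> {..<n}"
      then have a: "a < n" by simp
      note dims = carrier_matD[OF V[OF a]] carrier_matD[OF J(1)] carrier_matD[OF Z] carrier_matD[OF G[OF a]]
      have "(R a)\<^sup>\<dagger> * G a * R a = J\<^sup>\<dagger> * ((V a)\<^sup>\<dagger> * G a) * (V a * J)"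
        using dims by (simp add: R_def adjoint_mult mat_ring_dim(1))
      also have "\<dots> = J\<^sup>\<dagger> * Z * ((V a)\<^sup>\<dagger> * V a) * J"
        unfolding ZV[OF a, symmetric] using dims by (simp add: mat_ring_dim(1))
      finally show "(R a)\<^sup>\<dagger> * G a * R a = J\<^sup>\<dagger> * Z * ((V a)\<^sup>\<dagger> * V a) * J" .
    qed
    also have "\<dots> = (J\<^sup>\<dagger> * Z) * mat_sum n (\<lambda>a. (V a)\<^sup>\<dagger> * V a) {..<n} * J"
    proof (rule mat_sum_mult[symmetric])
      show "J\<^sup>\<dagger> * Z \<in> carrier_mat s n" using J Z by auto
      show "(V a)\<^sup>\<dagger> * V a \<in> carrier_mat n n" if "a \<in> {..<n}" for a using V[of a] that by auto
    qed (rule J)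
    also have "\<dots> = J\<^sup>\<dagger> * Z * J"
      unfolding one using carrier_matD[OF J(1)] carrier_matD[OF Z] by (simp add: mat_ring_dim)
    finally show ?thesis .
  qed
  have compl: "mat_sum s (\<lambda>a. (R a)\<^sup>\<dagger> * (1\<^sub>m 2 - G a) * R a) {..<n} = 1\<^sub>m s - J\<^sup>\<dagger> * Z * J"
    if Z: "Z \<in> carrier_mat n n" and G: "\<And>a. a < n \<Longrightarrow> G a \<in> carrier_mat 2 2"
      and ZV: "\<And>a. a < n \<Longrightarrow> Z * (V a)\<^sup>\<dagger> = (V a)\<^sup>\<dagger> * G a" for Z G
  proof -
    have "mat_sum s (\<lambda>a. (R a)\<^sup>\<dagger> * (1\<^sub>m 2 - G a) * R a) {..<n} = J\<^sup>\<dagger> * (1\<^sub>m n - Z) * J"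
    proof (rule key)
      fix a assume a: "a < n"
      show "1\<^sub>m 2 - G a \<in> carrier_mat 2 2" using G[OF a] by auto
      show "(1\<^sub>m n - Z) * (V a)\<^sup>\<dagger> = (V a)\<^sup>\<dagger> * (1\<^sub>m 2 - G a)"
        using carrier_matD[OF V[OF a]] carrier_matD[OF Z] carrier_matD[OF G[OF a]] ZV[OF a]
        by (simp add: mat_ring_dim)
    qed (use Z in auto)
    also have "\<dots> = 1\<^sub>m s - J\<^sup>\<dagger> * Z * J"
      using carrier_matD[OF J(1)] carrier_matD[OF Z] J(2) by (simp add: mat_ring_dim)
    finally show ?thesis .
  qed
  have RR: "mat_sum s (\<lambda>a. (R a)\<^sup>\<dagger> * R a) {..<n} = 1\<^sub>m s"
  proof -
    have "mat_sum s (\<lambda>a. (R a)\<^sup>\<dagger> * R a) {..<n} = mat_sum s (\<lambda>a. (R a)\<^sup>\<dagger> * 1\<^sub>m 2 * R a) {..<n}"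
      by (intro mat_sum_cong) (simp add: mat_ring_dim carrier_matD[OF R])
    also have "\<dots> = J\<^sup>\<dagger> * 1\<^sub>m n * J"
      by (intro key) (auto simp: mat_ring_dim carrier_matD[OF V])
    also have "\<dots> = 1\<^sub>m s" using J by (simp add: mat_ring_dim)
    finally show ?thesis .
  qed
  have "X ! i = mat_sum s (\<lambda>a. (R a)\<^sup>\<dagger> * (Y a ! i) * R a) {..<n}" if "i < 2 + 2" for i
  proof -
    have "i = 0 \<or> i = 1 \<or> i = 2 \<or> i = 3" using that by auto
    then show ?thesis
      using key[OF Pc Ac PV] key[OF Qc Bc QV] compl[OF Pc Ac PV] compl[OF Qc Bc QV] P(2) Q(2)
      by (auto simp: X Y_def numeral_2_eq_2 numeral_3_eq_3)
  qed
  then show "X \<in> mconv (2 + 2) 2 (B_ph 2 2 2) s"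
    unfolding mconv_def using Y R RR
    by (intro CollectI conjI exI[of _ n] exI[of _ Y] exI[of _ R]) (auto simp: X)
qed

theorem theorem4p5:
  fixes p q :: nat
  assumes "p \<ge> 2" and "q \<ge> 2"
  shows "(\<forall>s\<ge>1. {X. arveson_boundary_point (B_ph p q) s X} =
                {E @ F | E F. pvm p s E \<and> pvm q s F}) \<and>
         (p = 2 \<and> q = 2 \<longrightarrow>
           generated_by_level (p + q) (B_ph p q) 2 \<and>
           (\<forall>s\<ge>1. \<forall>X. arveson_boundary_point (B_ph p q) s X \<and> irreducible_point s X \<longrightarrow> s \<le> 2)) \<and>
         (max p q \<ge> 3 \<longrightarrow>
           (\<forall>N. \<exists>s\<ge>N. 1 \<le> s \<and>
              (\<exists>X. arveson_boundary_point (B_ph p q) s X \<and> irreducible_point s X)) \<and>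
           \<not> (\<exists>d\<ge>1. generated_by_level (p + q) (B_ph p q) d))"
proof (intro conjI impI)
  show "\<forall>s\<ge>1. {X. arveson_boundary_point (B_ph p q) s X} = {E @ F | E F. pvm p s E \<and> pvm q s F}"
    using arveson_imp_pvm_pair pvm_pair_arveson by blast
next
  assume pq: "p = 2 \<and> q = 2"
  show "generated_by_level (p + q) (B_ph p q) 2"
    using pq B_ph_2_2_subset_mconv mconv_B_ph_subset unfolding generated_by_level_def by blast
  show "\<forall>s\<ge>1. \<forall>X. arveson_boundary_point (B_ph p q) s X \<and> irreducible_point s X \<longrightarrow> s \<le> 2"
  proof (intro allI impI)
    fix s X assume s: "1 \<le> s" and X: "arveson_boundary_point (B_ph p q) s X \<and> irreducible_point s X"
    then obtain E F where EF: "X = E @ F" "pvm p s E" "pvm q s F"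
      using arveson_imp_pvm_pair[of s p q X] by auto
    \<comment> \<open>Level 2 has just been shown to generate, so every irreducible boundary point
      lies in its hull and the size bound applies with d = 2.\<close>
    have "E @ F \<in> mconv (p + q) 2 (B_ph p q 2) s"
      using pvm_pair_B_ph[OF EF(2,3)] pq B_ph_2_2_subset_mconv[of s] by auto
    then show "s \<le> 2" using irreducible_pvm_pair_size[OF EF(2,3)] X EF(1) s by blast
  qed
next
  assume max: "3 \<le> max p q"
  show "\<forall>N. \<exists>s\<ge>N. 1 \<le> s \<and> (\<exists>X. arveson_boundary_point (B_ph p q) s X \<and> irreducible_point s X)"
  proof
    fix N
    obtain E F where "pvm p (2 * N + 1) E" "pvm q (2 * N + 1) F" "irreducible_point (2 * N + 1) (E @ F)"
      using irreducible_pvm_pair_exists[OF assms max] .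
    then show "\<exists>s\<ge>N. 1 \<le> s \<and> (\<exists>X. arveson_boundary_point (B_ph p q) s X \<and> irreducible_point s X)"
      by (intro exI[of _ "2 * N + 1"]) (auto intro: pvm_pair_arveson)
  qed
  show "\<not> (\<exists>d\<ge>1. generated_by_level (p + q) (B_ph p q) d)"
  proof
    assume "\<exists>d\<ge>1. generated_by_level (p + q) (B_ph p q) d"
    then obtain d where gen: "generated_by_level (p + q) (B_ph p q) d" by blast
    obtain E F where EF: "pvm p (2 * d + 1) E" "pvm q (2 * d + 1) F" "irreducible_point (2 * d + 1) (E @ F)"
      using irreducible_pvm_pair_exists[OF assms max] .
    have "E @ F \<in> mconv (p + q) d (B_ph p q d) (2 * d + 1)"
      using pvm_pair_B_ph[OF EF(1,2)] gen unfolding generated_by_level_def by auto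
    then show False using irreducible_pvm_pair_size[OF EF, of d] by simp
  qed
qed

end
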